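(* Every finite simple subcubic outerplanar graph admits a crumby coloring.
   Context: A graph is subcubic if every vertex has degree at most three. A crumby coloring of a graph $G$ is a map $c:V(G)\to\{\text{blue},\text{red}\}$ such that: the subgraph induced by the blue vertices has maximum degree at most one; and the subgraph induced by the red vertices has no isolated vertices (every red vertex has a red neighbor) and contains no simple path with three edges (this path is a subgraph, not required to be induced). If there are no red vertices, the red conditions hold vacuously; if there are no blue vertices, the blue condition holds vacuously. *)

theory Defs
  imports "Graph_Theory.Pair_Digraph" "Graph_Theory.Digraph_Component" "HOL-Analysis.Analysis"
begin

text \<open>
  Graphs follow the convention of the AFP entry Graph\_Theory: a finite simple graph is a
  \<^locale>\<open>pair_graph\<close>, that is, a finite loopless digraph without parallel arcs whose arc relation is
  symmetric. An edge is a pair of opposite arcs, so the degree of a vertex is its out-degree.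
\<close>

definition subcubic :: "('a, 'b) pre_digraph \<Rightarrow> bool" where
  "subcubic G \<longleftrightarrow> (\<forall>v \<in> verts G. out_degree G v \<le> 3)"

text \<open>
  Drawings in the plane, which is the type \<^typ>\<open>complex\<close>: vertices are distinct points and edges are
  simple arcs (\<^const>\<open>arc\<close> is an injective path) that meet only in the points of common end
  vertices. The two orientations of an edge are drawn as the same curve.
\<close>

definition plane_drawing ::
  "'a pair_pre_digraph \<Rightarrow> ('a \<Rightarrow> complex) \<Rightarrow> ('a \<times> 'a \<Rightarrow> real \<Rightarrow> complex) \<Rightarrow> bool" where
  "plane_drawing G pos curve \<longleftrightarrow>
     inj_on pos (pverts G) \<and>
     (\<forall>(u, v) \<in> parcs G.
        arc (curve (u, v)) \<and> pathstart (curve (u, v)) = pos u \<and> pathfinish (curve (u, v)) = pos v \<and>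
        curve (v, u) = reversepath (curve (u, v)) \<and>
        path_image (curve (u, v)) \<inter> pos ` pverts G = {pos u, pos v}) \<and>
     (\<forall>(u, v) \<in> parcs G. \<forall>(x, y) \<in> parcs G. {u, v} \<noteq> {x, y} \<longrightarrow>
        path_image (curve (u, v)) \<inter> path_image (curve (x, y)) \<subseteq> pos ` ({u, v} \<inter> {x, y}))"

definition drawing_set ::
  "'a pair_pre_digraph \<Rightarrow> ('a \<Rightarrow> complex) \<Rightarrow> ('a \<times> 'a \<Rightarrow> real \<Rightarrow> complex) \<Rightarrow> complex set" where
  "drawing_set G pos curve = pos ` pverts G \<union> (\<Union>e \<in> parcs G. path_image (curve e))"

text \<open>
  The drawing of a finite graph is compact, so \<^const>\<open>outside\<close>, the union of the unbounded components
  of its complement, is the outer face.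
\<close>

definition outerplanar :: "'a pair_pre_digraph \<Rightarrow> bool" where
  "outerplanar G \<longleftrightarrow>
     (\<exists>pos curve. plane_drawing G pos curve \<and>
        pos ` pverts G \<subseteq> frontier (outside (drawing_set G pos curve)))"

datatype color = Blue | Red

definition color_subgraph ::
  "('a, 'b) pre_digraph \<Rightarrow> ('a \<Rightarrow> color) \<Rightarrow> color \<Rightarrow> ('a, 'b) pre_digraph" where
  "color_subgraph G c k = G \<restriction> {v \<in> verts G. c v = k}"

text \<open>
  Only the values of the coloring on the vertices of \<open>G\<close> matter.
  A simple path with three edges is an \<^const>\<open>pre_digraph.apath\<close> (a walk, given by its list of arcs,
  that repeats no vertex) of length 3; arcs between its vertices other than those used are allowed.
\<close>

definition crumby_coloring :: "('a, 'b) pre_digraph \<Rightarrow> ('a \<Rightarrow> color) \<Rightarrow> bool" where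
  "crumby_coloring G c \<longleftrightarrow>
     (let B = color_subgraph G c Blue; R = color_subgraph G c Red in
       (\<forall>v \<in> verts B. out_degree B v \<le> 1) \<and>
       (\<forall>v \<in> verts R. \<exists>u \<in> verts R. v \<rightarrow>\<^bsub>R\<^esub> u) \<and>
       \<not> (\<exists>u p v. pre_digraph.apath R u p v \<and> length p = 3))"

end

theory Submission
  imports Defs "HOL-Complex_Analysis.Winding_Numbers"
begin

text \<open>
  An outerplanar graph contains no theta: two vertices are never joined through three disjoint
  connected vertex sets. Indeed a theta in a drawing with all vertices on the outer face would give three
  arcs none of which runs inside the closed curve formed by the other two, so the three insides
  would be disjoint; but the winding numbers of the three closed curves around a point add up to zero.

  A connected subcubic graph without theta, other than \<open>K\<^sub>4\<close>, has a vertex of degree at most two, and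
  removing it leaves pieces attached by one or two edges. Such a piece decomposes further: a piece with
  two attaching edges is a chain of vertices, of vertices that carry a piece with one attaching edge, and of
  chords that span a shorter chain. For each piece consider the set of label pairs (or the relation between
  label pairs) on the attaching edges that extend to a valid labelling of the piece. Finitely many
  of these sets and relations suffice as lower bounds, which is a finite computation, and each
  of them can be completed at the vertex of degree at most two.
\<close>

section \<open>Theta curves in the plane\<close>

text \<open>Outerplanarity has two minimal obstructions, \<open>K_4\<close> and
  \<open>K_{2,3}\<close>. Excluding thetas only rules out the second, which is why
  \<open>K_4\<close> survives as an exception; it is labelled by hand instead of being excluded by
  another topological argument. Red components without a path of three edges are stars or triangles.
  Asking for stars only is stronger, but it turns a condition on paths into one on a vertex and its
  neighbours. A piece then influences the rest of the graph only through the labels at its attaching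
  edges, and pieces can be labelled independently. There are infinitely many pieces, but being a
  lower bound for the extendable states is preserved when the bound shrinks. A finite family
  therefore works as soon as it is closed in the sense that every operation on listed bounds yields
  something above a listed bound. The final vertex must have degree at most two: deleting a vertex
  of degree three may leave a piece with three attaching edges, for which no family is kept.\<close>

lemma simple_path_theta_loop:
  fixes p q :: "real \<Rightarrow> complex"
  assumes "arc p" "arc q" and "pathstart p = a" "pathfinish p = b" "pathstart q = a" "pathfinish q = b"
    and "path_image p \<inter> path_image q = {a, b}"
  shows "simple_path (p +++ reversepath q)" "pathfinish (p +++ reversepath q) = pathstart (p +++ reversepath q)"
    "path_image (p +++ reversepath q) = path_image p \<union> path_image q"
  using assms by (auto simp: simple_path_join_loop_eq arc_imp_simple_path arc_reversepath path_image_join)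

text \<open>The inside of the loop \<open>p\<close>, \<open>q\<close> is connected and misses the
  loop \<open>q\<close>, \<open>r\<close>, so if it met the inside of that loop it would be
  contained in it; likewise with the roles exchanged. Equal insides have equal frontiers, so the two
  loops would be the same set, although \<open>p\<close> has points off \<open>q\<close> and
  \<open>r\<close>.\<close>

lemma theta_inside_disjoint:
  fixes p q r :: "real \<Rightarrow> complex"
  assumes arcs: "arc p" "arc q" "arc r"
    and ends: "pathstart p = a" "pathfinish p = b" "pathstart q = a" "pathfinish q = b"
      "pathstart r = a" "pathfinish r = b"
    and pq: "path_image p \<inter> path_image q = {a, b}"
    and pr: "path_image p \<inter> path_image r = {a, b}"
    and qr: "path_image q \<inter> path_image r = {a, b}"
    and p_out: "path_image p \<inter> inside (path_image q \<union> path_image r) = {}"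
    and r_out: "path_image r \<inter> inside (path_image p \<union> path_image q) = {}"
  shows "inside (path_image p \<union> path_image q) \<inter> inside (path_image q \<union> path_image r) = {}"
proof (rule ccontr)
  let ?P = "path_image p" and ?Q = "path_image q" and ?R = "path_image r"
  note l1 = simple_path_theta_loop[OF arcs(1,2) ends(1-4) pq]
  note l2 = simple_path_theta_loop[OF arcs(2,3) ends(3-6) qr]
  note J1 = Jordan_inside_outside[OF l1(1,2), unfolded l1(3)]
  note J2 = Jordan_inside_outside[OF l2(1,2), unfolded l2(3)]
  assume ne: "inside (?P \<union> ?Q) \<inter> inside (?Q \<union> ?R) \<noteq> {}"
  have sub: "A \<subseteq> inside T" if "Topological_Spaces.connected A" "A \<inter> T = {}" "A \<inter> inside T \<noteq> {}"
      "open (inside T)" "open (outside T)" for A T :: "complex set"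
  proof -
    have "A \<subseteq> inside T \<union> outside T" using that(2) by (auto simp: inside_Un_outside)
    then have "A \<inter> outside T = {}"
      using connectedD[OF that(1,4,5)] that(3) inside_Int_outside[of T] by blast
    then show ?thesis using \<open>A \<subseteq> inside T \<union> outside T\<close> by blast
  qed
  have d1: "inside (?P \<union> ?Q) \<inter> (?Q \<union> ?R) = {}"
    using r_out inside_no_overlap[of "?P \<union> ?Q"] unfolding disjoint_iff by blast
  have d2: "inside (?Q \<union> ?R) \<inter> (?P \<union> ?Q) = {}"
    using p_out inside_no_overlap[of "?Q \<union> ?R"] unfolding disjoint_iff by blast
  have "inside (?P \<union> ?Q) \<subseteq> inside (?Q \<union> ?R)" "inside (?Q \<union> ?R) \<subseteq> inside (?P \<union> ?Q)"
    by (rule sub[OF _ d1] sub[OF _ d2]; use ne J1 J2 in \<open>simp add: Int_commute\<close>)+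
  then have "frontier (inside (?P \<union> ?Q)) = frontier (inside (?Q \<union> ?R))" by simp
  then have "?P \<union> ?Q = ?Q \<union> ?R" using J1 J2 by metis
  moreover obtain x where x: "x \<in> ?P" "x \<notin> {a, b}"
    using nonempty_simple_path_endless[OF arc_imp_simple_path[OF arcs(1)]] ends by auto
  ultimately have "x \<in> ?P \<inter> ?Q \<or> x \<in> ?P \<inter> ?R" by blast
  then show False unfolding pq pr using x by simp
qed

text \<open>The position of the arcs enters only through the points \<open>p1\<close>,
  \<open>p2\<close>, \<open>p3\<close>: an arc without its ends is connected and avoids the loop of
  the other two, so one point not inside that loop keeps the whole arc out. A point inside one loop
  then lies outside the other two, where the winding numbers vanish, while the first loop has
  winding number of norm 1.\<close>

lemma no_theta:
  fixes c1 c2 c3 :: "real \<Rightarrow> complex"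
  assumes arcs: "arc c1" "arc c2" "arc c3"
    and ends: "pathstart c1 = a" "pathfinish c1 = b" "pathstart c2 = a" "pathfinish c2 = b"
      "pathstart c3 = a" "pathfinish c3 = b"
    and i12: "path_image c1 \<inter> path_image c2 = {a, b}"
    and i13: "path_image c1 \<inter> path_image c3 = {a, b}"
    and i23: "path_image c2 \<inter> path_image c3 = {a, b}"
    and p1: "p1 \<in> path_image c1 - {a, b}" "p1 \<notin> inside (path_image c2 \<union> path_image c3)"
    and p2: "p2 \<in> path_image c2 - {a, b}" "p2 \<notin> inside (path_image c1 \<union> path_image c3)"
    and p3: "p3 \<in> path_image c3 - {a, b}" "p3 \<notin> inside (path_image c1 \<union> path_image c2)"
  shows False
proof -
  let ?A = "path_image c1" and ?B = "path_image c2" and ?C = "path_image c3"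
  have out: "path_image r \<inter> inside (path_image p \<union> path_image q) = {}"
    if "arc p" "arc q" "arc r" "pathstart p = a" "pathfinish p = b" "pathstart q = a" "pathfinish q = b"
      "pathstart r = a" "pathfinish r = b" "path_image p \<inter> path_image q = {a, b}"
      "path_image p \<inter> path_image r = {a, b}" "path_image q \<inter> path_image r = {a, b}"
      "x \<in> path_image r - {a, b}" "x \<notin> inside (path_image p \<union> path_image q)"
    for p q r :: "real \<Rightarrow> complex" and x
  proof -
    let ?T = "path_image p \<union> path_image q"
    note l = simple_path_theta_loop[OF that(1,2,4-7,10)]
    note J = Jordan_inside_outside[OF l(1,2), unfolded l(3)]
    have "Topological_Spaces.connected (path_image r - {a, b})"
      using connected_simple_path_endless[OF arc_imp_simple_path[OF that(3)]] that by simp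
    moreover have "path_image r - {a, b} \<subseteq> inside ?T \<union> outside ?T"
      using that(11,12) by (auto simp: inside_Un_outside)
    moreover have "x \<in> outside ?T" using calculation(2) that(13,14) by blast
    moreover have "open (inside ?T)" "open (outside ?T)" using J by simp_all
    ultimately have "(path_image r - {a, b}) \<inter> inside ?T = {}"
      using connectedD[of "path_image r - {a, b}" "inside ?T" "outside ?T"] that(13) inside_Int_outside[of ?T]
      by blast
    moreover have "a \<in> ?T" "b \<in> ?T" using that(4,5) by (auto simp: pathstart_in_path_image)
    then have "a \<notin> inside ?T" "b \<notin> inside ?T" using inside_no_overlap[of ?T] by blast+
    ultimately show ?thesis by blast
  qed
  have c: "?B \<inter> ?A = {a, b}" "?C \<inter> ?A = {a, b}" "?C \<inter> ?B = {a, b}"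
    using i12 i13 i23 by (simp_all add: Int_commute)
  have o3: "?C \<inter> inside (?A \<union> ?B) = {}"
    by (rule out[OF arcs ends i12 i13 i23 p3])
  have o2: "?B \<inter> inside (?A \<union> ?C) = {}"
    by (rule out[OF arcs(1,3,2) ends(1,2,5,6,3,4) i13 i12 c(3) p2])
  have o1: "?A \<inter> inside (?B \<union> ?C) = {}"
    by (rule out[OF arcs(2,3,1) ends(3-6) ends(1,2) i23 c(1,2) p1])
  have j123: "inside (?A \<union> ?B) \<inter> inside (?B \<union> ?C) = {}"
    by (rule theta_inside_disjoint[OF arcs ends i12 i13 i23 o1 o3])
  have j213: "inside (?B \<union> ?A) \<inter> inside (?A \<union> ?C) = {}"
    using o2 o3 by (intro theta_inside_disjoint[OF arcs(2,1,3) ends(3,4,1,2,5,6) c(1) i23 i13]) (simp_all add: Un_commute)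
  note l12 = simple_path_theta_loop[OF arcs(1,2) ends(1-4) i12]
  note l23 = simple_path_theta_loop[OF arcs(2,3) ends(3-6) i23]
  note l13 = simple_path_theta_loop[OF arcs(1,3) ends(1,2,5,6) i13]
  obtain z where z: "z \<in> inside (?A \<union> ?B)"
    using Jordan_inside_outside[OF l12(1,2)] l12(3) by auto
  then have zn: "z \<notin> ?A" "z \<notin> ?B" "z \<notin> ?C"
    using o3 inside_no_overlap[of "?A \<union> ?B"] by blast+
  have wn: "winding_number (p +++ reversepath q) z = winding_number p z - winding_number q z"
    if "arc p" "arc q" "z \<notin> path_image p" "z \<notin> path_image q" "pathfinish p = pathfinish q" for p q
    using that by (simp add: winding_number_join winding_number_reversepath arc_imp_path)
  have "z \<in> outside (?B \<union> ?C)" "z \<in> outside (?A \<union> ?C)"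
    using z zn j123 j213 unfolding outside_inside Un_commute[of ?B ?A] by blast+
  then have "winding_number (c2 +++ reversepath c3) z = 0" "winding_number (c1 +++ reversepath c3) z = 0"
    using winding_number_zero_in_outside[OF simple_path_imp_path[OF l23(1)] l23(2)]
      winding_number_zero_in_outside[OF simple_path_imp_path[OF l13(1)] l13(2)] l23(3) l13(3) by simp_all
  then have "winding_number (c1 +++ reversepath c2) z = 0"
    using wn arcs ends zn by simp
  then show False
    using simple_closed_path_norm_winding_number_inside[OF l12(1), of z] l12(3) z by simp
qed

section \<open>Connected vertex sets\<close>

text \<open>Both ends are forced into \<open>S\<close>; hence \<open>component E S x\<close> is
  empty for \<open>x\<close> outside \<open>S\<close>.\<close>

inductive reach :: "('a \<Rightarrow> 'a \<Rightarrow> bool) \<Rightarrow> 'a set \<Rightarrow> 'a \<Rightarrow> 'a \<Rightarrow> bool" for E S where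
  refl: "x \<in> S \<Longrightarrow> reach E S x x"
| step: "reach E S x y \<Longrightarrow> E y z \<Longrightarrow> z \<in> S \<Longrightarrow> reach E S x z"

definition conn :: "('a \<Rightarrow> 'a \<Rightarrow> bool) \<Rightarrow> 'a set \<Rightarrow> bool" where
  "conn E S \<longleftrightarrow> (\<forall>x\<in>S. \<forall>y\<in>S. reach E S x y)"

definition component :: "('a \<Rightarrow> 'a \<Rightarrow> bool) \<Rightarrow> 'a set \<Rightarrow> 'a \<Rightarrow> 'a set" where
  "component E S x = {y. reach E S x y}"

text \<open>Connected sets replace the inner parts of three disjoint paths because they arise
  directly as components after deleting vertices. The neighbour clauses make them nonempty, so an
  edge between \<open>u\<close> and \<open>v\<close> is not a strand and \<open>K_4\<close> is
  theta-free.\<close>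

definition theta_free :: "('a \<Rightarrow> 'a \<Rightarrow> bool) \<Rightarrow> bool" where
  "theta_free E \<longleftrightarrow> \<not> (\<exists>u v X Y Z. u \<noteq> v \<and> {u, v} \<inter> (X \<union> Y \<union> Z) = {} \<and>
     X \<inter> Y = {} \<and> X \<inter> Z = {} \<and> Y \<inter> Z = {} \<and>
     (\<forall>W\<in>{X, Y, Z}. conn E W \<and> (\<exists>x\<in>W. E u x) \<and> (\<exists>x\<in>W. E v x)))"

lemma reach_in: "reach E S x y \<Longrightarrow> x \<in> S \<and> y \<in> S"
  by (induction rule: reach.induct) auto

lemma reach_trans: "reach E S y z \<Longrightarrow> reach E S x y \<Longrightarrow> reach E S x z"
  by (induction rule: reach.induct) (auto intro: reach.step)

lemma reach_mono: "reach E S x y \<Longrightarrow> S \<subseteq> T \<Longrightarrow> reach E T x y"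
  by (induction rule: reach.induct) (auto intro: reach.intros)

lemma reach_component: "reach E S x y \<Longrightarrow> reach E (component E S x) x y"
  by (induction rule: reach.induct) (auto simp: component_def intro: reach.intros)

lemma component_subset: "component E S x \<subseteq> S"
  unfolding component_def using reach_in by fast

lemma component_self: "x \<in> S \<Longrightarrow> x \<in> component E S x"
  by (simp add: component_def reach.refl)

lemma component_closed: "y \<in> component E S x \<Longrightarrow> E y z \<Longrightarrow> z \<in> S \<Longrightarrow> z \<in> component E S x"
  by (auto simp: component_def intro: reach.step)

text \<open>Cut the walk just before its first visit to \<open>u\<close>.\<close>

lemma reach_avoid:
  "reach E S x y \<Longrightarrow> x \<noteq> u \<Longrightarrow> reach E (S - {u}) x y \<or> (\<exists>z. reach E (S - {u}) x z \<and> E z u)"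
proof (induction rule: reach.induct)
  case (step x y z)
  then show ?case by (cases "z = u") (auto intro: reach.intros)
qed (auto intro: reach.intros)

lemma conn_singleton: "conn E {x}"
  by (simp add: conn_def reach.refl)

lemma conn_empty: "conn E {}"
  by (simp add: conn_def)

locale symmetric_relation =
  fixes E :: "'a \<Rightarrow> 'a \<Rightarrow> bool"
  assumes sym: "E x y \<Longrightarrow> E y x"
begin

lemma reach_sym: "reach E S x y \<Longrightarrow> reach E S y x"
proof (induction rule: reach.induct)
  case (step x y z)
  have "reach E S z y"
    using step.hyps reach_in[OF step.hyps(1)] by (auto intro: reach.intros sym)
  then show ?case using step.IH reach_trans by metis
qed (simp add: reach.refl)

lemma conn_component: "conn E (component E S x)"
  unfolding conn_def
proof (intro ballI)
  fix y z assume "y \<in> component E S x" "z \<in> component E S x"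
  then have "reach E (component E S x) x y" "reach E (component E S x) x z"
    using reach_component[of E S x] unfolding component_def[of E S x] mem_Collect_eq by blast+
  then show "reach E (component E S x) y z" using reach_sym reach_trans by metis
qed

lemma component_sym: "y \<in> component E S x \<longleftrightarrow> x \<in> component E S y"
  unfolding component_def mem_Collect_eq using reach_sym by blast

lemma component_eq: "y \<in> component E S x \<Longrightarrow> component E S y = component E S x"
  unfolding component_def using reach_sym reach_trans by fast

lemma component_disjoint: "y \<notin> component E S x \<Longrightarrow> component E S x \<inter> component E S y = {}"
  using component_eq component_sym by (metis disjoint_iff component_subset component_self subsetD)

lemma component_neighbour:
  assumes "conn E S" "u \<in> S" "y \<in> S" "y \<noteq> u"
  obtains x where "x \<in> component E (S - {u}) y" "E u x"
proof -
  have "reach E S y u" using assms by (simp add: conn_def)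
  from reach_avoid[OF this assms(4)] obtain z where "reach E (S - {u}) y z" "E z u"
    using reach_in by fast
  then show ?thesis using that sym by (auto simp: component_def)
qed

lemma conn_Un:
  assumes "conn E A" "conn E B" "a \<in> A" "b \<in> B" "E a b"
  shows "conn E (A \<union> B)"
proof -
  have ab: "reach E (A \<union> B) a b" using assms by (auto intro: reach.intros)
  have "reach E (A \<union> B) a x" if "x \<in> A \<union> B" for x
  proof (cases "x \<in> A")
    case True
    then show ?thesis using assms reach_mono[of E A a x "A \<union> B"] by (auto simp: conn_def)
  next
    case False
    then have "reach E (A \<union> B) b x" using assms that reach_mono[of E B b x "A \<union> B"] by (auto simp: conn_def)
    then show ?thesis using ab reach_trans by metis
  qed
  then show ?thesis unfolding conn_def using reach_sym reach_trans by metis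
qed

lemma conn_insert: "conn E A \<Longrightarrow> a \<in> A \<Longrightarrow> E u a \<Longrightarrow> conn E (insert u A)"
  using conn_Un[OF conn_singleton, of A u u a] by simp

text \<open>\<open>A\<close> plays the path from \<open>a\<close> to a branching vertex
  \<open>t\<close>, without \<open>t\<close>. It is empty when \<open>a\<close> is \<open>t\<close>;
  whatever is attached at \<open>a\<close> then touches \<open>t\<close> directly.\<close>

definition leg :: "'a \<Rightarrow> 'a \<Rightarrow> 'a set \<Rightarrow> bool" where
  "leg t a A \<longleftrightarrow> (if a = t then A = {} else t \<notin> A \<and> conn E A \<and> a \<in> A \<and> (\<exists>s\<in>A. E t s))"

text \<open>The branching vertex of a subtree spanning \<open>a\<close>, \<open>b\<close>,
  \<open>c\<close> is found by walking from \<open>a\<close>: as long as the other two share a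
  component of \<open>K - {a}\<close>, pass to that component and to a neighbour of \<open>a\<close>
  in it. Once they are separated, or one of them is \<open>a\<close>, the current vertex
  branches.\<close>

lemma median:
  assumes "finite K" "conn E K" "a \<in> K" "b \<in> K" "c \<in> K"
  obtains t A B C where "t \<in> K" "A \<union> B \<union> C \<subseteq> K" "A \<inter> B = {}" "A \<inter> C = {}" "B \<inter> C = {}"
    "leg t a A" "leg t b B" "leg t c C"
proof -
  have "\<exists>t A B C. t \<in> K \<and> A \<union> B \<union> C \<subseteq> K \<and> A \<inter> B = {} \<and> A \<inter> C = {} \<and> B \<inter> C = {} \<and>
    leg t a A \<and> leg t b B \<and> leg t c C"
    using assms
  proof (induction "card K" arbitrary: K a b c rule: less_induct)
    case less
    have leg0: "leg a a {}" for a by (simp add: leg_def conn_empty)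
    have leg1: "leg a b (component E (K - {a}) b)" "component E (K - {a}) b \<subseteq> K" if "b \<in> K" "a \<in> K" "b \<noteq> a" for a b
      using component_neighbour[OF less.prems(2) that(2,1,3)] component_subset[of E "K - {a}" b] that
        component_self[of b "K - {a}" E] by (auto simp: leg_def conn_component)
    consider "b = a" "c = a" | "b = a" "c \<noteq> a" | "b \<noteq> a" "c = a"
      | "b \<noteq> a" "c \<noteq> a" "c \<notin> component E (K - {a}) b" | "b \<noteq> a" "c \<in> component E (K - {a}) b"
      by blast
    then show ?case
    proof cases
      case 1
      then show ?thesis using leg0[of a] less.prems by (intro exI[of _ a] exI[of _ "{}"]) simp
    next
      case 2
      then show ?thesis using leg0[of a] leg1[of c a] less.prems
        by (intro exI[of _ a] exI[of _ "{}"] exI[of _ "component E (K - {a}) c"]) simp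
    next
      case 3
      then show ?thesis using leg0[of a] leg1[of b a] less.prems
        by (intro exI[of _ a] exI[of _ "{}"] exI[of _ "component E (K - {a}) b"] exI[of _ "{}"]) simp
    next
      case 4
      let ?B = "component E (K - {a}) b" and ?C = "component E (K - {a}) c"
      have "?B \<inter> ?C = {}" by (rule component_disjoint[OF 4(3)])
      moreover have "leg a b ?B" "?B \<subseteq> K" "leg a c ?C" "?C \<subseteq> K" using leg1 4 less.prems by simp_all
      ultimately show ?thesis using leg0[of a] less.prems
        by (intro exI[of _ a] exI[of _ "{}"] exI[of _ ?B] exI[of _ ?C]) simp
    next
      case 5
      let ?M = "component E (K - {a}) b"
      have M: "?M \<subseteq> K - {a}" by (rule component_subset)
      then have card: "card ?M < card K" using less.prems by (intro psubset_card_mono) auto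
      have fin: "finite ?M" using finite_subset[OF M] less.prems(1) by simp
      obtain s where s: "s \<in> ?M" "E a s"
        using component_neighbour[OF less.prems(2,3,4) 5(1)] by metis
      have b: "b \<in> ?M" using 5 less.prems by (intro component_self) auto
      obtain t S B C where t: "t \<in> ?M" "S \<union> B \<union> C \<subseteq> ?M" "S \<inter> B = {}" "S \<inter> C = {}" "B \<inter> C = {}"
          "leg t s S" "leg t b B" "leg t c C"
        using less.hyps[OF card fin conn_component s(1) b 5(2)] by blast
      \<comment> \<open>The recursion started at the neighbour \<open>s\<close>, so \<open>a\<close>
        is put back at the end of its leg. When \<open>s\<close> is itself the branching vertex, the
        empty leg becomes \<open>{a}\<close>.\<close>
      define S' where "S' = insert a S"
      have "conn E S'"
        using t(6) s by (auto simp: S'_def leg_def conn_singleton intro: conn_insert split: if_splits)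
      moreover have "\<exists>r\<in>S'. E t r" using t(6) s sym by (auto simp: S'_def leg_def split: if_splits)
      ultimately have "leg t a S'" using t(1,6) M by (auto simp: S'_def leg_def split: if_splits)
      moreover have "a \<notin> B" "a \<notin> C" "a \<in> K" "B \<subseteq> K" "C \<subseteq> K" "S \<subseteq> K" "t \<in> K"
        using t(1,2) M less.prems by auto
      then have "S' \<inter> B = {}" "S' \<inter> C = {}" "S' \<union> B \<union> C \<subseteq> K" "t \<in> K"
        using t(3,4) by (auto simp: S'_def)
      ultimately show ?thesis using t(5,7,8) by blast
    qed
  qed
  then show ?thesis using that by metis
qed

lemma component_adjacent:
  assumes "reach E S a b" "a \<noteq> b"
  obtains q where "q \<in> component E (S - {b}) a" "E b q"
  using reach_avoid[OF assms(1,2)] reach_in[of E "S - {b}" a b] sym that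
  unfolding component_def by blast

lemma leg_extend:
  assumes "leg t a A" "E a z" "z \<in> Z" "conn E Z"
  shows "conn E (A \<union> Z)" "\<exists>k\<in>A \<union> Z. E t k"
  using assms conn_Un[of A Z a z] by (auto simp: leg_def split: if_splits)

lemma component_boundary:
  "k \<in> component E (S - A) x \<Longrightarrow> E k m \<Longrightarrow> m \<notin> component E (S - A) x \<Longrightarrow> m \<in> A \<or> m \<notin> S"
  using component_closed[of k E "S - A" x m] by blast

lemma component_cover:
  assumes "conn E S" "u \<in> S"
  shows "S = insert u (\<Union>x\<in>{x. E u x} \<inter> S. component E (S - {u}) x)"
proof
  show "S \<subseteq> insert u (\<Union>x\<in>{x. E u x} \<inter> S. component E (S - {u}) x)"
  proof
    fix y assume y: "y \<in> S"
    show "y \<in> insert u (\<Union>x\<in>{x. E u x} \<inter> S. component E (S - {u}) x)"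
    proof (cases "y = u")
      case False
      then obtain x where x: "x \<in> component E (S - {u}) y" "E u x"
        using component_neighbour[OF assms y] by metis
      then have "x \<in> S" using component_subset by fast
      moreover have "y \<in> component E (S - {u}) x" using x component_sym by metis
      ultimately show ?thesis using x by blast
    qed simp
  qed
  show "insert u (\<Union>x\<in>{x. E u x} \<inter> S. component E (S - {u}) x) \<subseteq> S"
    using component_subset assms(2) by fast
qed

end

text \<open>Oriented with the inner end first, so that an equation such as
  \<open>bd S = {(u, w)}\<close> names both ends of every attaching edge.\<close>

definition boundary :: "('a \<Rightarrow> 'a \<Rightarrow> bool) \<Rightarrow> 'a set \<Rightarrow> ('a \<times> 'a) set" where
  "boundary E S = {(a, b). a \<in> S \<and> b \<notin> S \<and> E a b}"

locale subcubic_graph = symmetric_relation E for E :: "'a \<Rightarrow> 'a \<Rightarrow> bool" +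
  fixes V :: "'a set"
  assumes finite_V: "finite V" and edge_V: "E u v \<Longrightarrow> u \<in> V" and irrefl: "\<not> E u u"
    and degree: "card {v. E u v} \<le> 3"
begin

abbreviation N :: "'a \<Rightarrow> 'a set" where "N u \<equiv> {v. E u v}"

abbreviation bd :: "'a set \<Rightarrow> ('a \<times> 'a) set" where "bd \<equiv> boundary E"

text \<open>A pendant piece is attached to the rest of the graph by one edge, a link or a chain by two
  edges. In \<open>link S u w u' w'\<close> the attaching edges are \<open>u w\<close> and \<open>u' w'\<close> with \<open>u, u' \<in> S\<close>.\<close>

inductive pendant :: "'a set \<Rightarrow> 'a \<Rightarrow> 'a \<Rightarrow> bool"
  and link :: "'a set \<Rightarrow> 'a \<Rightarrow> 'a \<Rightarrow> 'a \<Rightarrow> 'a \<Rightarrow> bool"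
  and chain :: "'a set \<Rightarrow> 'a \<Rightarrow> 'a \<Rightarrow> 'a \<Rightarrow> 'a \<Rightarrow> bool"
where
  leaf: "N u = {w} \<Longrightarrow> pendant {u} u w"
| one_child: "\<lbrakk>N u = {w, x}; distinct [w, x]; pendant T x u; bd T = {(x, u)}; w \<notin> T\<rbrakk>
    \<Longrightarrow> pendant (insert u T) u w"
| two_children: "\<lbrakk>N u = {w, x, y}; distinct [w, x, y]; pendant T x u; pendant T' y u;
    bd T = {(x, u)}; bd T' = {(y, u)}; T \<inter> T' = {}; w \<notin> T; w \<notin> T'\<rbrakk>
    \<Longrightarrow> pendant (insert u (T \<union> T')) u w"
| cycle: "\<lbrakk>N u = {w, x, y}; distinct [w, x, y]; chain T x u y u; bd T = {(x, u), (y, u)}; w \<notin> T\<rbrakk>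
    \<Longrightarrow> pendant (insert u T) u w"
| vertex: "\<lbrakk>N u = {w, q}; distinct [w, q]\<rbrakk> \<Longrightarrow> link {u} u w u q"
| vertex_pendant: "\<lbrakk>N u = {w, y, q}; distinct [w, y, q]; pendant T y u; bd T = {(y, u)}; w \<notin> T; q \<notin> T\<rbrakk>
    \<Longrightarrow> link (insert u T) u w u q"
| chord: "\<lbrakk>N u = {w, a, b}; distinct [w, a, b]; N b = {q, p, u}; distinct [q, p, u];
    chain T a u p b; bd T = {(a, u), (p, b)}; w \<notin> T; q \<notin> T\<rbrakk>
    \<Longrightarrow> link (insert u (insert b T)) u w b q"
| single: "link P u w b q \<Longrightarrow> chain P u w b q"
| append: "\<lbrakk>link P u w b q; chain R q b u' w'; P \<inter> R = {}; u \<in> P; b \<in> P; q \<in> R; u' \<in> R;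
    w \<notin> R; w' \<notin> P; bd R = {(q, b), (u', w')}\<rbrakk> \<Longrightarrow> chain (P \<union> R) u w u' w'"

end

section \<open>Outerplanar graphs contain no theta\<close>

lemma pair_graph_arcD:
  assumes "pair_graph G" "(u, v) \<in> parcs G"
  shows "u \<in> pverts G \<and> v \<in> pverts G \<and> u \<noteq> v \<and> (v, u) \<in> parcs G"
proof -
  interpret pair_graph G by (rule assms(1))
  show ?thesis using assms(2) in_arcsD1 in_arcsD2 no_loops' arcs_symmetric by auto
qed

context
  fixes G :: "'a pair_pre_digraph" and pos :: "'a \<Rightarrow> complex" and curve :: "'a \<times> 'a \<Rightarrow> real \<Rightarrow> complex"
  assumes pg: "pair_graph G" and drawing: "plane_drawing G pos curve"
begin

lemmas arcs_in_verts = pair_graph_arcD[OF pg]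

lemma pos_inj: "\<lbrakk>u \<in> pverts G; v \<in> pverts G\<rbrakk> \<Longrightarrow> pos u = pos v \<longleftrightarrow> u = v"
  using drawing by (auto simp: plane_drawing_def inj_on_def)

lemma curve_props:
  assumes "(u, v) \<in> parcs G"
  shows "arc (curve (u, v))" "pathstart (curve (u, v)) = pos u" "pathfinish (curve (u, v)) = pos v"
    "curve (v, u) = reversepath (curve (u, v))"
    "path_image (curve (u, v)) \<inter> pos ` pverts G = {pos u, pos v}"
  using drawing assms unfolding plane_drawing_def by blast+

lemma pos_curve_iff:
  assumes "(u, v) \<in> parcs G" "w \<in> pverts G"
  shows "pos w \<in> path_image (curve (u, v)) \<longleftrightarrow> w = u \<or> w = v"
proof -
  have "pos w \<in> path_image (curve (u, v)) \<longleftrightarrow> pos w \<in> path_image (curve (u, v)) \<inter> pos ` pverts G"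
    using assms(2) by simp
  also have "\<dots> \<longleftrightarrow> pos w = pos u \<or> pos w = pos v"
    unfolding curve_props(5)[OF assms(1)] by simp
  finally show ?thesis using pos_inj assms arcs_in_verts[OF assms(1)] by simp
qed

lemma curve_Int:
  assumes "(u, v) \<in> parcs G" "(x, y) \<in> parcs G" "{u, v} \<noteq> {x, y}"
  shows "path_image (curve (u, v)) \<inter> path_image (curve (x, y)) \<subseteq> pos ` ({u, v} \<inter> {x, y})"
  using drawing assms unfolding plane_drawing_def by blast

definition sub_drawing :: "'a set \<Rightarrow> complex set" where
  "sub_drawing S = pos ` S \<union> (\<Union>e \<in> parcs G \<inter> S \<times> S. path_image (curve e))"

lemma reach_path_component:
  assumes "reach (\<lambda>u v. (u, v) \<in> parcs G) S x y"
  shows "path_component (sub_drawing S) (pos x) (pos y)"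
  using assms
proof (induction rule: reach.induct)
  case (refl x)
  then show ?case by (auto simp: path_component_refl_eq sub_drawing_def)
next
  case (step x y z)
  note c = curve_props[OF step.hyps(2)]
  have "y \<in> S" using reach_in step.hyps(1) by fast
  then have "path_image (curve (y, z)) \<subseteq> sub_drawing S"
    using step.hyps by (force simp: sub_drawing_def)
  then have "path_component (sub_drawing S) (pos y) (pos z)"
    unfolding path_component_def using c arc_imp_path by blast
  then show ?case using step.IH path_component_trans by blast
qed

lemma curve_sub_drawing:
  assumes "S \<subseteq> pverts G" "(u, x) \<in> parcs G" "u \<notin> S" "x \<in> S"
  shows "path_image (curve (u, x)) \<inter> sub_drawing S = {pos x}"
proof -
  have "path_image (curve (u, x)) \<inter> path_image (curve (a, b)) \<subseteq> {pos x}"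
    if "(a, b) \<in> parcs G" "a \<in> S" "b \<in> S" for a b
  proof -
    have "{u, x} \<noteq> {a, b}" "{u, x} \<inter> {a, b} \<subseteq> {x}" using that(2,3) assms(3) by auto
    then show ?thesis using curve_Int[OF assms(2) that(1)] by blast
  qed
  moreover have "w = x" if "w \<in> S" "pos w \<in> path_image (curve (u, x))" for w
    using that pos_curve_iff[OF assms(2), of w] assms(1,3) by auto
  moreover have "pos x \<in> path_image (curve (u, x))"
    using pos_curve_iff[OF assms(2)] assms(1,4) by auto
  moreover have "pos x \<in> sub_drawing S" using assms by (simp add: sub_drawing_def)
  ultimately show ?thesis by (auto simp: sub_drawing_def)
qed

lemma sub_drawing_iff:
  "z \<in> sub_drawing S \<longleftrightarrow>
    (\<exists>w\<in>S. z = pos w) \<or> (\<exists>a\<in>S. \<exists>b\<in>S. (a, b) \<in> parcs G \<and> z \<in> path_image (curve (a, b)))"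
  by (auto simp: sub_drawing_def)

lemma sub_drawing_disjoint:
  assumes "S \<subseteq> pverts G" "T \<subseteq> pverts G" "S \<inter> T = {}"
  shows "sub_drawing S \<inter> sub_drawing T = {}"
proof -
  have 1: "path_image (curve (a, b)) \<inter> path_image (curve (c, d)) = {}"
    if "(a, b) \<in> parcs G" "(c, d) \<in> parcs G" "a \<in> S" "b \<in> S" "c \<in> T" "d \<in> T" for a b c d
  proof -
    have "{a, b} \<inter> {c, d} = {}" "{a, b} \<noteq> {c, d}" using that assms(3) by auto
    then show ?thesis using curve_Int[OF that(1,2)] by simp
  qed
  have ST: "w \<in> pverts G \<and> w \<notin> T" if "w \<in> S" for w using that assms by auto
  have TS: "w \<in> pverts G \<and> w \<notin> S" if "w \<in> T" for w using that assms by auto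
  have 2: "z \<notin> sub_drawing T" if "a \<in> S" "z = pos a" for z a
    using that ST TS pos_inj pos_curve_iff unfolding sub_drawing_iff by metis
  have 3: "z \<notin> sub_drawing T" if "a \<in> S" "b \<in> S" "(a, b) \<in> parcs G" "z \<in> path_image (curve (a, b))" for z a b
    using that 1 ST TS pos_curve_iff unfolding sub_drawing_iff disjoint_iff by metis
  show ?thesis
    unfolding disjoint_iff using 2 3 sub_drawing_iff[of _ S] by metis
qed

text \<open>The drawing of the connected set \<open>S\<close> joins \<open>pos x\<close> to
  \<open>pos y\<close> by a path, which contains an arc; the attaching curves are glued to it.
  Passing through \<open>pos x\<close> supplies the vertex point that \<open>no_theta\<close>
  needs.\<close>

lemma strand:
  assumes "conn (\<lambda>u v. (u, v) \<in> parcs G) S" "u \<notin> S" "v \<notin> S" "u \<noteq> v"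
    "x \<in> S" "(u, x) \<in> parcs G" "y \<in> S" "(v, y) \<in> parcs G" "S \<subseteq> pverts G"
  obtains c where "arc c" "pathstart c = pos u" "pathfinish c = pos v" "pos x \<in> path_image c"
    "path_image c \<subseteq> path_image (curve (u, x)) \<union> sub_drawing S \<union> path_image (curve (v, y))"
proof -
  let ?U = "curve (u, x)" and ?W = "curve (v, y)"
  note U = curve_props[OF assms(6)] and W = curve_props[OF assms(8)]
  have uS: "path_image ?U \<inter> sub_drawing S = {pos x}"
    by (rule curve_sub_drawing) (use assms in auto)
  have wS: "path_image ?W \<inter> sub_drawing S = {pos y}"
    by (rule curve_sub_drawing) (use assms in auto)
  have ne: "{u, x} \<noteq> {v, y}" using assms by auto
  have UW: "path_image ?U \<inter> path_image ?W \<subseteq> pos ` ({u, x} \<inter> {v, y})"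
    by (rule curve_Int) (use assms ne in auto)
  show ?thesis
  \<comment> \<open>With \<open>x = y\<close> the middle part would be a constant path, which is not
    an arc, so the two attaching curves are joined directly.\<close>
  proof (cases "x = y")
    case True
    have "path_image ?U \<inter> path_image ?W \<subseteq> {pos x}" using UW assms True by auto
    then have "arc (?U +++ reversepath ?W)"
      using U W True by (intro arc_join) (auto simp: arc_reversepath)
    then show ?thesis
      using that[of "?U +++ reversepath ?W"] U W True
      by (auto simp: path_image_join pathfinish_in_path_image)
  next
    case False
    have "path_component (sub_drawing S) (pos x) (pos y)"
      using assms by (intro reach_path_component) (auto simp: conn_def)
    moreover have "pos x \<noteq> pos y" using False assms pos_inj by blast
    ultimately obtain g where g: "arc g" "pathstart g = pos x" "pathfinish g = pos y"
        "path_image g \<subseteq> sub_drawing S"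
      unfolding path_component_def by (metis path_contains_arc subset_trans)
    have "path_image ?U \<inter> path_image ?W = {}" using UW assms False by auto
    moreover have "path_image ?U \<inter> path_image g \<subseteq> {pos x}" using uS g by blast
    moreover have gw: "path_image ?W \<inter> path_image g \<subseteq> {pos y}" using wS g by blast
    ultimately have "arc (?U +++ (g +++ reversepath ?W))"
      using U W g by (intro arc_join) (auto simp: arc_reversepath path_image_join)
    moreover have "path_image (?U +++ (g +++ reversepath ?W)) \<subseteq> path_image ?U \<union> sub_drawing S \<union> path_image ?W"
      using g U W by (auto simp: path_image_join)
    ultimately show ?thesis
      using that[of "?U +++ (g +++ reversepath ?W)"] U W g
      by (auto simp: path_image_join pathfinish_in_path_image)
  qed
qed

text \<open>Stated for the whole region available to a strand, because the arc chosen in it is not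
  determined. Distinct edges meet only in common end vertices, and the only vertices shared by the
  two regions are \<open>u\<close> and \<open>v\<close>.\<close>

lemma strand_Int:
  assumes "S \<subseteq> pverts G" "T \<subseteq> pverts G" "S \<inter> T = {}" "{u, v} \<inter> (S \<union> T) = {}" "u \<noteq> v"
    and S: "x \<in> S" "(u, x) \<in> parcs G" "y \<in> S" "(v, y) \<in> parcs G"
    and T: "x' \<in> T" "(u, x') \<in> parcs G" "y' \<in> T" "(v, y') \<in> parcs G"
  shows "(path_image (curve (u, x)) \<union> sub_drawing S \<union> path_image (curve (v, y))) \<inter>
    (path_image (curve (u, x')) \<union> sub_drawing T \<union> path_image (curve (v, y'))) \<subseteq> {pos u, pos v}"
proof -
  have c: "path_image (curve (a, x)) \<inter> path_image (curve (b, y)) \<subseteq> {pos u, pos v}"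
    if "a \<in> {u, v}" "b \<in> {u, v}" "x \<in> S" "y \<in> T" "(a, x) \<in> parcs G" "(b, y) \<in> parcs G" for a b x y
  proof -
    have "{a, x} \<noteq> {b, y}" "{a, x} \<inter> {b, y} \<subseteq> {u, v}" using that assms by auto
    then show ?thesis using curve_Int[OF that(5,6)] by blast
  qed
  have d: "path_image (curve (a, x)) \<inter> sub_drawing B \<subseteq> {pos u, pos v}"
    if "a \<in> {u, v}" "x \<in> A" "(a, x) \<in> parcs G" "A \<inter> B = {}" "B \<subseteq> pverts G" "{u, v} \<inter> B = {}" for a x A B
  proof -
    note that_d = that
    have "path_image (curve (a, x)) \<inter> path_image (curve (c, d)) = {}"
      if cd: "(c, d) \<in> parcs G" "c \<in> B" "d \<in> B" for c d
    proof -
      have "{a, x} \<inter> {c, d} = {}" "{a, x} \<noteq> {c, d}"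
        using \<open>a \<in> {u, v}\<close> \<open>x \<in> A\<close> \<open>A \<inter> B = {}\<close> \<open>{u, v} \<inter> B = {}\<close> cd by auto
      then show ?thesis using curve_Int[OF that_d(3) cd(1)] by auto
    qed
    moreover have "pos w \<notin> path_image (curve (a, x))" if w: "w \<in> B" for w
      using pos_curve_iff[OF \<open>(a, x) \<in> parcs G\<close>, of w] w that_d by auto
    ultimately have "path_image (curve (a, x)) \<inter> sub_drawing B = {}"
      unfolding disjoint_iff sub_drawing_iff by metis
    then show ?thesis by simp
  qed
  note cc = c[of u u x x'] c[of u v x y'] c[of v u y x'] c[of v v y y']
    d[of u x S T] d[of v y S T] d[of u x' T S] d[of v y' T S]
  have "sub_drawing S \<inter> sub_drawing T = {}" by (rule sub_drawing_disjoint) (use assms in auto)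
  then show ?thesis using cc assms by (simp add: Int_commute Int_Un_distrib Int_Un_distrib2)
qed

lemma sub_drawing_subset: "S \<subseteq> pverts G \<Longrightarrow> sub_drawing S \<subseteq> drawing_set G pos curve"
  by (auto simp: sub_drawing_def drawing_set_def)

text \<open>A frontier point of \<open>outside D\<close> in the open set \<open>inside S\<close>
  would make \<open>inside S\<close> meet \<open>outside D\<close>, but the smaller set has the
  larger outside.\<close>

lemma frontier_outside_not_inside:
  assumes "S \<subseteq> D" "closed S" "p \<in> frontier (outside D)"
  shows "p \<notin> inside (S :: complex set)"
proof
  assume p: "p \<in> inside S"
  have "open (inside S)" using assms(2) open_inside by blast
  moreover have "p \<in> closure (outside D)" using assms(3) by (auto simp: frontier_def)
  ultimately have "inside S \<inter> outside D \<noteq> {}"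
    using p open_Int_closure_eq_empty by blast
  then show False using outside_mono[OF assms(1)] inside_Int_outside[of S] by blast
qed

lemma theta_free_drawing:
  assumes outer: "pos ` pverts G \<subseteq> frontier (outside (drawing_set G pos curve))"
  shows "theta_free (\<lambda>u v. (u, v) \<in> parcs G)"
  unfolding theta_free_def
proof (rule notI, elim exE conjE)
  fix u v X Y Z
  let ?E = "\<lambda>u v. (u, v) \<in> parcs G"
  assume uv: "u \<noteq> v" and disj: "{u, v} \<inter> (X \<union> Y \<union> Z) = {}" "X \<inter> Y = {}" "X \<inter> Z = {}" "Y \<inter> Z = {}"
    and W: "\<forall>W\<in>{X, Y, Z}. conn ?E W \<and> (\<exists>x\<in>W. ?E u x) \<and> (\<exists>x\<in>W. ?E v x)"
  let ?st = "\<lambda>S x y. path_image (curve (u, x)) \<union> sub_drawing S \<union> path_image (curve (v, y))"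
  have S: "\<exists>x y c. x \<in> S \<and> y \<in> S \<and> S \<subseteq> pverts G \<and> (u, x) \<in> parcs G \<and> (v, y) \<in> parcs G \<and>
      arc c \<and> pathstart c = pos u \<and> pathfinish c = pos v \<and> pos x \<in> path_image c \<and>
      path_image c \<subseteq> ?st S x y" if S: "S \<in> {X, Y, Z}" for S
  proof -
    obtain x y where xy: "x \<in> S" "(u, x) \<in> parcs G" "y \<in> S" "(v, y) \<in> parcs G" "conn ?E S"
      using W S by blast
    \<comment> \<open>\<open>theta_free\<close> ranges over arbitrary vertex sets; connectedness and
      one edge into \<open>S\<close> confine \<open>S\<close> to the graph.\<close>
    have "z \<in> pverts G" if "reach ?E S x z" for z
      using that by (cases rule: reach.cases) (use arcs_in_verts xy in auto)
    then have sub: "S \<subseteq> pverts G" using xy unfolding conn_def by blast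
    have "u \<notin> S" "v \<notin> S" using S disj by auto
    then show ?thesis using strand[OF xy(5) _ _ uv xy(1-4) sub] xy sub by metis
  qed
  obtain x1 y1 c1 where 1: "x1 \<in> X" "y1 \<in> X" "X \<subseteq> pverts G" "(u, x1) \<in> parcs G" "(v, y1) \<in> parcs G"
    "arc c1" "pathstart c1 = pos u" "pathfinish c1 = pos v" "pos x1 \<in> path_image c1"
    "path_image c1 \<subseteq> ?st X x1 y1" using S[of X] by auto
  obtain x2 y2 c2 where 2: "x2 \<in> Y" "y2 \<in> Y" "Y \<subseteq> pverts G" "(u, x2) \<in> parcs G" "(v, y2) \<in> parcs G"
    "arc c2" "pathstart c2 = pos u" "pathfinish c2 = pos v" "pos x2 \<in> path_image c2"
    "path_image c2 \<subseteq> ?st Y x2 y2" using S[of Y] by auto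
  obtain x3 y3 c3 where 3: "x3 \<in> Z" "y3 \<in> Z" "Z \<subseteq> pverts G" "(u, x3) \<in> parcs G" "(v, y3) \<in> parcs G"
    "arc c3" "pathstart c3 = pos u" "pathfinish c3 = pos v" "pos x3 \<in> path_image c3"
    "path_image c3 \<subseteq> ?st Z x3 y3" using S[of Z] by auto
  have I: "path_image c \<inter> path_image d = {pos u, pos v}"
    if "path_image c \<inter> path_image d \<subseteq> {pos u, pos v}"
      "pathstart c = pos u" "pathfinish c = pos v" "pathstart d = pos u" "pathfinish d = pos v" for c d
  proof -
    have "pos u \<in> path_image c" "pos v \<in> path_image c" "pos u \<in> path_image d" "pos v \<in> path_image d"
      using that(2-5) pathstart_in_path_image pathfinish_in_path_image by metis+
    then show ?thesis using that(1) by blast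
  qed
  have st: "?st X x1 y1 \<inter> ?st Y x2 y2 \<subseteq> {pos u, pos v}" "?st X x1 y1 \<inter> ?st Z x3 y3 \<subseteq> {pos u, pos v}"
    "?st Y x2 y2 \<inter> ?st Z x3 y3 \<subseteq> {pos u, pos v}"
    by (intro strand_Int; use 1 2 3 uv disj in \<open>auto\<close>)+
  have i12: "path_image c1 \<inter> path_image c2 = {pos u, pos v}"
    by (rule I[OF subset_trans[OF Int_mono[OF 1(10) 2(10)] st(1)]]) (use 1 2 in auto)
  have i13: "path_image c1 \<inter> path_image c3 = {pos u, pos v}"
    by (rule I[OF subset_trans[OF Int_mono[OF 1(10) 3(10)] st(2)]]) (use 1 3 in auto)
  have i23: "path_image c2 \<inter> path_image c3 = {pos u, pos v}"
    by (rule I[OF subset_trans[OF Int_mono[OF 2(10) 3(10)] st(3)]]) (use 2 3 in auto)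
  have stD: "?st S x y \<subseteq> drawing_set G pos curve"
    if "S \<subseteq> pverts G" "(u, x) \<in> parcs G" "(v, y) \<in> parcs G" for S x y
    using sub_drawing_subset[OF that(1)] that by (auto simp: drawing_set_def)
  have D: "path_image c1 \<subseteq> drawing_set G pos curve" "path_image c2 \<subseteq> drawing_set G pos curve"
     "path_image c3 \<subseteq> drawing_set G pos curve"
    using stD[OF 1(3-5)] stD[OF 2(3-5)] stD[OF 3(3-5)] 1(10) 2(10) 3(10) by blast+
  have ni: "pos x \<notin> inside (path_image c \<union> path_image d)"
    if "x \<in> pverts G" "arc c" "arc d" "path_image c \<subseteq> drawing_set G pos curve"
      "path_image d \<subseteq> drawing_set G pos curve" for x c d
    using that outer by (intro frontier_outside_not_inside) (auto simp: closed_arc_image closed_Un)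
  have ne: "pos x \<notin> {pos u, pos v}" if "x \<in> S" "S \<subseteq> pverts G" "u \<notin> S" "v \<notin> S" for x S
    using that pos_inj[of x] arcs_in_verts[OF 1(4)] arcs_in_verts[OF 1(5)] by auto
  show False
    by (rule no_theta[OF 1(6) 2(6) 3(6) 1(7,8) 2(7,8) 3(7,8) i12 i13 i23, of "pos x1" "pos x2" "pos x3"])
      (use 1 2 3 D disj ni ne in auto)
qed

end

lemma outerplanar_theta_free:
  assumes "pair_graph G" "outerplanar G"
  shows "theta_free (\<lambda>u v. (u, v) \<in> parcs G)"
  using assms theta_free_drawing unfolding outerplanar_def by blast

section \<open>Decomposition into pieces\<close>

lemma boundary_iff: "(a, b) \<in> boundary E S \<longleftrightarrow> a \<in> S \<and> b \<notin> S \<and> E a b"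
  by (simp add: boundary_def)

lemma card_le_2_cases:
  assumes "finite A" "card A \<le> 2"
  obtains "A = {}" | x where "A = {x}" | x y where "A = {x, y}" "x \<noteq> y"
proof -
  consider "card A = 0" | "card A = 1" | "card A = 2" using assms(2) by linarith
  then show ?thesis
    by cases (use assms(1) that in \<open>auto simp: card_1_singleton_iff card_2_iff\<close>)
qed

context subcubic_graph
begin

lemma finite_N: "finite (N u)"
  using finite_V edge_V sym by (metis finite_subset mem_Collect_eq subsetI)

lemma N_eqI:
  assumes "E u a" "E u b" "E u c" "distinct [a, b, c]"
  shows "N u = {a, b, c}"
proof -
  have "{a, b, c} \<subseteq> N u" "card {a, b, c} = 3" using assms by auto
  then show ?thesis using card_seteq[OF finite_N, of "{a, b, c}" u] degree[of u] by auto
qed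

text \<open>A component of \<open>S - {u}\<close> has no edge to another component, so its attaching
  edges either go to \<open>u\<close> or are inherited from \<open>S\<close>. The bookkeeping of
  attaching edges below rests on this.\<close>

lemma component_boundary_eq:
  assumes "T = component E (S - {u}) x" "u \<in> S"
  shows "bd T = {(k, u) | k. k \<in> N u \<inter> T} \<union> {(k, m) \<in> bd S. k \<in> T}"
proof -
  have "T \<subseteq> S - {u}" using assms(1) component_subset by metis
  moreover have "m = u \<or> m \<notin> S" if "k \<in> T" "E k m" "m \<notin> T" for k m
    using component_boundary[of k S "{u}" x m] that unfolding assms(1) by blast
  moreover have "E k u \<longleftrightarrow> E u k" for k using sym by blast
  ultimately show ?thesis using assms(2) unfolding boundary_def
    by (intro set_eqI) (clarsimp, metis Diff_iff singletonI subsetD)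
qed

lemma component_cover_eq:
  assumes "conn E S" "u \<in> S" "N u \<inter> S = A"
  shows "S = insert u (\<Union>x\<in>A. component E (S - {u}) x)"
  using component_cover[OF assms(1,2)] unfolding assms(3) .

lemma theta_freeD:
  assumes "theta_free E" "u \<noteq> v" "u \<notin> X \<union> Y \<union> Z" "v \<notin> X \<union> Y \<union> Z" "X \<inter> Y = {}" "X \<inter> Z = {}" "Y \<inter> Z = {}"
    "conn E X" "conn E Y" "conn E Z" "\<exists>x\<in>X. E u x" "\<exists>x\<in>Y. E u x" "\<exists>x\<in>Z. E u x"
    "\<exists>x\<in>X. E v x" "\<exists>x\<in>Y. E v x" "\<exists>x\<in>Z. E v x"
  shows False
  using assms(1) unfolding theta_free_def
  by (rule notE)
    (intro exI[of _ u] exI[of _ v] exI[of _ X] exI[of _ Y] exI[of _ Z] conjI; use assms in \<open>simp\<close>)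

text \<open>The connected set \<open>M\<close> acts as the second branch vertex: a median of three
  attaching vertices in \<open>M\<close> takes that place, and its legs are absorbed into
  \<open>X\<close>, \<open>Y\<close> and \<open>Z\<close>.\<close>

lemma theta_free_tripod:
  assumes tf: "theta_free E" and M: "conn E M" "M \<subseteq> V" "u \<notin> M"
    and conn: "conn E X" "conn E Y" "conn E Z"
    and disj: "X \<inter> Y = {}" "X \<inter> Z = {}" "Y \<inter> Z = {}" "M \<inter> X = {}" "M \<inter> Y = {}" "M \<inter> Z = {}"
    and u: "u \<notin> X" "u \<notin> Y" "u \<notin> Z" "\<exists>x\<in>X. E u x" "\<exists>x\<in>Y. E u x" "\<exists>x\<in>Z. E u x"
    and att: "\<exists>a\<in>M. \<exists>x\<in>X. E a x" "\<exists>a\<in>M. \<exists>x\<in>Y. E a x" "\<exists>a\<in>M. \<exists>x\<in>Z. E a x"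
  shows False
proof -
  obtain a b c x y z where
    a: "a \<in> M" "x \<in> X" "E a x" and b: "b \<in> M" "y \<in> Y" "E b y" and c: "c \<in> M" "z \<in> Z" "E c z"
    using att by blast
  obtain t A B C where t: "t \<in> M" "A \<union> B \<union> C \<subseteq> M" "A \<inter> B = {}" "A \<inter> C = {}" "B \<inter> C = {}"
    and legs: "leg t a A" "leg t b B" "leg t c C"
    using median[OF finite_subset[OF M(2) finite_V] M(1) a(1) b(1) c(1)] by metis
  have nt: "t \<notin> A" "t \<notin> B" "t \<notin> C" using legs by (auto simp: leg_def split: if_splits)
  have sub: "A \<subseteq> M" "B \<subseteq> M" "C \<subseteq> M" using t(2) by auto
  have D: "(P \<union> X') \<inter> (Q \<union> Y') = {}"
    if "P \<inter> Q = {}" "P \<subseteq> M" "Q \<subseteq> M" "X' \<inter> Y' = {}" "M \<inter> X' = {}" "M \<inter> Y' = {}" for P Q X' Y'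
    using that by auto
  have tX: "t \<notin> X" "t \<notin> Y" "t \<notin> Z" using t(1) disj by auto
  have uM: "u \<notin> A" "u \<notin> B" "u \<notin> C" "u \<noteq> t" using M(3) sub t(1) by auto
  have I: "(A \<union> X) \<inter> (B \<union> Y) = {}" "(A \<union> X) \<inter> (C \<union> Z) = {}" "(B \<union> Y) \<inter> (C \<union> Z) = {}"
    using D t(3-5) sub disj by simp_all
  have u': "\<exists>x\<in>A \<union> X. E u x" "\<exists>x\<in>B \<union> Y. E u x" "\<exists>x\<in>C \<union> Z. E u x" using u(4-6) by auto
  note L = leg_extend[OF legs(1) a(3,2) conn(1)] leg_extend[OF legs(2) b(3,2) conn(2)]
      leg_extend[OF legs(3) c(3,2) conn(3)]
  show False
    by (rule theta_freeD[OF tf uM(4) _ _ I L(1,3,5) u' L(2,4,6)]) (use uM nt tX u in simp_all)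
qed

text \<open>Otherwise the component of \<open>z\<close> in \<open>T - {x} - {y}\<close> touches
  \<open>x\<close>, \<open>y\<close> and, through \<open>w'\<close>, the set \<open>Z\<close>, and
  so does \<open>u\<close>: a tripod. Hence one of the neighbours \<open>x\<close>, \<open>y\<close>
  of \<open>u\<close> cuts the other off from the exit \<open>z\<close>, and its edge to
  \<open>u\<close> can serve as a chord.\<close>

lemma chord_end:
  assumes tf: "theta_free E"
    and T: "conn E T" "T \<subseteq> V" "x \<in> T" "y \<in> T" "x \<noteq> y" "z \<in> T"
    and u: "u \<notin> T" "E u x" "E u y" "E u w"
    and Z: "conn E Z" "Z \<inter> T = {}" "u \<notin> Z" "w \<in> Z" "w' \<in> Z" "E z w'"
  shows "z \<notin> component E (T - {x}) y \<or> z \<notin> component E (T - {y}) x"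
proof (rule ccontr)
  assume "\<not> ?thesis"
  then have zy: "reach E (T - {x}) z y" and zx: "reach E (T - {y}) z x"
    using reach_sym by (auto simp: component_def)
  then have ne: "z \<noteq> x" "z \<noteq> y" using reach_in by fast+
  let ?M = "component E (T - {x} - {y}) z"
  have eq: "T - {y} - {x} = T - {x} - {y}" by blast
  obtain r where r: "r \<in> ?M" "E y r" using component_adjacent[OF zy] ne by blast
  obtain s where s: "s \<in> ?M" "E x s" using component_adjacent[OF zx] ne unfolding eq by blast
  have M: "?M \<subseteq> T - {x} - {y}" by (rule component_subset)
  have z: "z \<in> ?M" using T ne by (intro component_self) simp
  show False
  proof (rule theta_free_tripod[OF tf conn_component _ _ conn_singleton conn_singleton Z(1)])
    show "?M \<subseteq> V" "u \<notin> ?M" using M T(2) u(1) by auto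
    show "{x} \<inter> {y} = {}" "{x} \<inter> Z = {}" "{y} \<inter> Z = {}" using T Z(2) by auto
    show "?M \<inter> {x} = {}" "?M \<inter> {y} = {}" "?M \<inter> Z = {}" using M Z(2) by auto
    show "u \<notin> {x}" "u \<notin> {y}" "u \<notin> Z" using u(1) T Z(3) by auto
    show "\<exists>k\<in>{x}. E u k" "\<exists>k\<in>{y}. E u k" "\<exists>k\<in>Z. E u k" using u Z by auto
    show "\<exists>a\<in>?M. \<exists>k\<in>{x}. E a k" "\<exists>a\<in>?M. \<exists>k\<in>{y}. E a k" "\<exists>a\<in>?M. \<exists>k\<in>Z. E a k"
      using s r z Z(5,6) sym by blast+
  qed
qed


text \<open>Induction on the size of \<open>S\<close>: delete the vertex \<open>u\<close> of the
  first attaching edge and sort the components by the neighbours of \<open>u\<close> that they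
  contain. \<open>Z\<close> connects the two outer ends outside \<open>S\<close>, which is what lets
  \<open>chord_end\<close> close up a theta. For a part of \<open>S\<close> it is rebuilt from the
  deleted vertices, together with the old \<open>Z\<close> when the far attaching edge is
  kept.\<close>

lemma decomposition:
  assumes tf: "theta_free E" and "S \<subseteq> V" "conn E S"
  shows pendant_decomposition: "bd S = {(u, w)} \<Longrightarrow> pendant S u w"
    and chain_decomposition: "\<lbrakk>bd S = {(u, w), (u', w')}; (u, w) \<noteq> (u', w');
      conn E Z; Z \<inter> S = {}; w \<in> Z; w' \<in> Z\<rbrakk> \<Longrightarrow> chain S u w u' w'"
proof -
  have "(bd S = {(u, w)} \<longrightarrow> pendant S u w) \<and>
    (bd S = {(u, w), (u', w')} \<longrightarrow> (u, w) \<noteq> (u', w') \<longrightarrow> conn E Z \<longrightarrow> Z \<inter> S = {} \<longrightarrow> w \<in> Z \<longrightarrow> w' \<in> Z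
      \<longrightarrow> chain S u w u' w')"
    using assms(2,3)
  proof (induction "card S" arbitrary: S u w u' w' Z rule: less_induct)
    case less
    have finS: "finite S" using less.prems finite_subset finite_V by metis
    have small: "card T < card S \<and> T \<subseteq> V" if "T \<subseteq> S - {v}" "v \<in> S" for T v
      using that less.prems(1) finS by (auto intro: psubset_card_mono)
    have pend: "pendant T x v" if "T \<subseteq> S - {r}" "r \<in> S" "conn E T" "bd T = {(x, v)}" for T x v r
      using less.hyps[of T x v] small[OF that(1,2)] that(3,4) by blast
    have chn: "chain T x v x' v'" if "T \<subseteq> S - {r}" "r \<in> S" "conn E T" "bd T = {(x, v), (x', v')}" "(x, v) \<noteq> (x', v')"
        "conn E Z" "Z \<inter> T = {}" "v \<in> Z" "v' \<in> Z" for T x v x' v' Z r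
      using less.hyps[of T x v x' v' Z] small[OF that(1,2)] that(3-) by blast
    let ?C = "component E (S - {u})"
    have C: "?C x \<subseteq> S - {u}" "conn E (?C x)" for x by (rule component_subset, rule conn_component)
    have Cself: "x \<in> ?C x" if "x \<in> N u \<inter> S" for x
      using that irrefl by (intro component_self) auto
    have NC: "N u \<inter> ?C x = (N u \<inter> S) \<inter> ?C x" for x using C(1)[of x] by auto
    have finNS: "finite (N u \<inter> S)" by (simp add: finite_N)
    have pendant: "pendant S u w" if bdS: "bd S = {(u, w)}"
    proof -
      have w: "E u w" "w \<notin> S" "u \<in> S" using bdS boundary_iff[of u w E S] by auto
      have Nu: "N u = insert w (N u \<inter> S)"
        using w bdS boundary_iff[of u _ E S] by auto
      have "card (N u) = Suc (card (N u \<inter> S))"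
        using Nu w finNS by (metis IntD2 card_insert_disjoint)
      then have c2: "card (N u \<inter> S) \<le> 2" using degree[of u] by linarith
      have bC: "bd (?C x) = {(k, u) | k. k \<in> N u \<inter> ?C x}" for x
        using component_boundary_eq[OF HOL.refl w(3), of x] bdS C(1)[of x] by auto
      note cover = component_cover_eq[OF less.prems(2) w(3)]
      from finNS c2 show ?thesis
      proof (cases rule: card_le_2_cases)
        case 1
        have "S = {u}" using cover[OF 1] by simp
        moreover have "N u = {w}" using Nu unfolding 1 .
        ultimately show ?thesis using leaf by simp
      next
        case (2 x)
        have S: "S = insert u (?C x)" using cover[OF 2] by simp
        have "N u \<inter> ?C x = {x}" using 2 Cself[of x] C(1)[of x] by blast
        then have b: "bd (?C x) = {(x, u)}" using bC[of x] by simp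
        have "pendant (?C x) x u" by (rule pend[OF C(1) w(3) C(2) b])
        moreover have "N u = {w, x}" using Nu unfolding 2 .
        moreover have "distinct [w, x]" using 2 w by auto
        moreover have "w \<notin> ?C x" using w C(1)[of x] by blast
        ultimately show ?thesis using one_child[of u w x "?C x"] b S by simp
      next
        case (3 x y)
        have N3: "N u = {w, x, y}" using Nu unfolding 3 .
        have "x \<in> S" "y \<in> S" using 3(1) by auto
        then have d: "distinct [w, x, y]" using 3(2) w(2) by auto
        have wn: "w \<notin> ?C x" "w \<notin> ?C y" using w C(1)[of x] C(1)[of y] by blast+
        have xx: "x \<in> ?C x" "y \<in> ?C y" using Cself 3 by auto
        have ux: "u \<notin> ?C x" using C(1)[of x] by blast
        show ?thesis
        proof (cases "y \<in> ?C x")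
          case True
          then have "?C y = ?C x" by (rule component_eq)
          then have S: "S = insert u (?C x)" using cover[OF 3(1)] by simp
          have "N u \<inter> ?C x = {x, y}" using 3 xx True C(1)[of x] by blast
          then have b: "bd (?C x) = {(x, u), (y, u)}" using bC[of x] by auto
          have "chain (?C x) x u y u"
            by (rule chn[OF C(1) w(3) C(2) b _ conn_singleton[of E u]]) (use 3(2) ux in simp_all)
          then show ?thesis using cycle[OF N3 d _ b wn(1)] S by simp
        next
          case False
          have disj: "?C x \<inter> ?C y = {}" by (rule component_disjoint[OF False])
          have S: "S = insert u (?C x \<union> ?C y)" using cover[OF 3(1)] by simp
          have "x \<notin> ?C y" using False component_sym by metis
          then have "N u \<inter> ?C x = {x}" "N u \<inter> ?C y = {y}" unfolding NC 3(1) using xx False by auto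
          then have b: "bd (?C x) = {(x, u)}" "bd (?C y) = {(y, u)}" using bC by auto
          have "pendant (?C x) x u" "pendant (?C y) y u"
            by (rule pend[OF C(1) w(3) C(2) b(1)], rule pend[OF C(1) w(3) C(2) b(2)])
          then show ?thesis using two_children[OF N3 d _ _ b disj wn] S by simp
        qed
      qed
    qed
    have chain: "chain S u w u' w'"
      if bdS: "bd S = {(u, w), (u', w')}" and ne: "(u, w) \<noteq> (u', w')"
        and Z: "conn E Z" "Z \<inter> S = {}" "w \<in> Z" "w' \<in> Z"
    proof -
      have w: "E u w" "w \<notin> S" "u \<in> S" "E u' w'" "w' \<notin> S" "u' \<in> S"
        using bdS boundary_iff[of u w E S] boundary_iff[of u' w' E S] by auto
      note cover = component_cover_eq[OF less.prems(2) w(3)]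
      show ?thesis
      \<comment> \<open>If \<open>u\<close> carries both attaching edges, at most one neighbour
        remains inside and the chain is a single link. Otherwise the far edge belongs to a component
        of the remainder.\<close>
      proof (cases "u' = u")
        case True
        have ww: "w \<noteq> w'" using ne True by simp
        have Nu: "N u = insert w (insert w' (N u \<inter> S))"
        proof -
          have "v = w \<or> v = w'" if "E u v" "v \<notin> S" for v
            using that bdS w(3) boundary_iff[of u v E S] by auto
          then show ?thesis using w(1,4) True by auto
        qed
        have "card (N u) = Suc (Suc (card (N u \<inter> S)))"
          using Nu w finNS ww by (metis IntD2 card_insert_disjoint finite_insert insertE)
        then have c1: "card (N u \<inter> S) \<le> 1" using degree[of u] by linarith
        have bC: "bd (?C x) = {(k, u) | k. k \<in> N u \<inter> ?C x}" for x
          using component_boundary_eq[OF HOL.refl w(3), of x] bdS True C(1)[of x] by auto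
        from c1 have "card (N u \<inter> S) \<le> 2" by simp
        with finNS show ?thesis
        proof (cases rule: card_le_2_cases)
          case 1
          have "S = {u}" using cover[OF 1] by simp
          moreover have "N u = {w, w'}" using Nu unfolding 1 .
          ultimately show ?thesis using single[OF vertex[of u w w']] ww True by simp
        next
          case (2 x)
          have S: "S = insert u (?C x)" using cover[OF 2] by simp
          have "N u \<inter> ?C x = {x}" using 2 Cself[of x] C(1)[of x] by blast
          then have b: "bd (?C x) = {(x, u)}" using bC[of x] by simp
          have "pendant (?C x) x u" by (rule pend[OF C(1) w(3) C(2) b])
          moreover have "N u = {w, x, w'}" using Nu unfolding 2 by blast
          moreover have "distinct [w, x, w']" using 2 w ww by auto
          moreover have "w \<notin> ?C x" "w' \<notin> ?C x" using w C(1)[of x] by blast+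
          ultimately show ?thesis using single[OF vertex_pendant[of u w x w' "?C x"]] b S True by simp
        next
          case (3 x y)
          then show ?thesis using c1 by simp
        qed
      next
        case False
        have Nu: "N u = insert w (N u \<inter> S)"
          using w bdS False boundary_iff[of u _ E S] by auto
        have "card (N u) = Suc (card (N u \<inter> S))"
          using Nu w finNS by (metis IntD2 card_insert_disjoint)
        then have c2: "card (N u \<inter> S) \<le> 2" using degree[of u] by linarith
        have bC: "bd (?C x) = {(k, u) | k. k \<in> N u \<inter> ?C x} \<union> (if u' \<in> ?C x then {(u', w')} else {})" for x
          using component_boundary_eq[OF HOL.refl w(3), of x] bdS C(1)[of x] by auto
        have Zu: "conn E (insert u Z)" by (rule conn_insert[OF Z(1,3) w(1)])
        have uZ: "u \<notin> Z" using Z(2) w(3) by blast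
        have w'u: "w' \<noteq> u" using w by blast
        have wn: "w \<notin> ?C x" "w' \<notin> ?C x" "u \<notin> ?C x" "insert u Z \<inter> ?C x = {}" for x
          using w C(1)[of x] Z(2) by blast+
        have tail: "chain (?C x) x u u' w'" "bd (?C x) = {(x, u), (u', w')}"
          if "N u \<inter> ?C x = {x}" "u' \<in> ?C x" for x
        proof -
          show b: "bd (?C x) = {(x, u), (u', w')}" using bC[of x] that by auto
          show "chain (?C x) x u u' w'"
            by (rule chn[OF C(1) w(3) C(2) b _ Zu wn(4)]) (use w'u Z in auto)
        qed
        from finNS c2 show ?thesis
        proof (cases rule: card_le_2_cases)
          case 1
          then show ?thesis using cover[OF 1] w(6) False by simp
        next
          case (2 x)
          have S: "{u} \<union> ?C x = S" using cover[OF 2] by simp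
          then have u': "u' \<in> ?C x" using w(6) False by blast
          have x: "x \<in> ?C x" "N u \<inter> ?C x = {x}" using 2 Cself[of x] C(1)[of x] by blast+
          have "link {u} u w u x" by (rule vertex) (use Nu 2 w in auto)
          then have "chain ({u} \<union> ?C x) u w u' w'"
            by (rule append[OF _ tail(1)[OF x(2) u'] _ _ _ x(1) u' wn(1) _ tail(2)[OF x(2) u']])
              (use wn(3) w'u in simp_all)
          then show ?thesis unfolding S .
        next
          case (3 x y)
          \<comment> \<open>The component without \<open>u'\<close> hangs on \<open>u\<close> by one
            edge, so it is pendant; the chain continues through the other one.\<close>
          have split: ?thesis if xy: "N u \<inter> S = {x, y}" "x \<noteq> y" "y \<notin> ?C x" "u' \<in> ?C x" for x y
          proof -
            have disj: "?C x \<inter> ?C y = {}" by (rule component_disjoint[OF xy(3)])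
            have S: "insert u (?C y) \<union> ?C x = S" using cover[OF xy(1)] by auto
            have xx: "x \<in> ?C x" "y \<in> ?C y" using Cself xy by auto
            have "x \<notin> ?C y" using xy(3) component_sym by metis
            then have n: "N u \<inter> ?C x = {x}" "N u \<inter> ?C y = {y}" unfolding NC xy(1) using xx xy(3) by auto
            have "u' \<notin> ?C y" using disj xy(4) by blast
            then have b: "bd (?C y) = {(y, u)}" using bC[of y] n(2) by simp
            have "pendant (?C y) y u" by (rule pend[OF C(1) w(3) C(2) b])
            moreover have "N u = {w, y, x}" using Nu unfolding xy(1) by blast
            moreover have "distinct [w, y, x]" using xy w by auto
            moreover have "x \<notin> ?C y" using disj xx by blast
            ultimately have "link (insert u (?C y)) u w u x"
              using vertex_pendant[of u w y x "?C y"] b wn(1)[of y] by blast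
            then have "chain (insert u (?C y) \<union> ?C x) u w u' w'"
              by (rule append[OF _ tail(1)[OF n(1) xy(4)] _ _ _ xx(1) xy(4) wn(1) _ tail(2)[OF n(1) xy(4)]])
                (use wn(2,3) w'u disj in \<open>simp_all add: Int_commute\<close>)
            then show ?thesis unfolding S .
          qed
          show ?thesis
          proof (cases "y \<in> ?C x")
            case False
            then have "x \<notin> ?C y" using component_sym by metis
            moreover have "u' \<in> ?C x \<or> u' \<in> ?C y" using cover[OF 3(1)] w(6) \<open>u' \<noteq> u\<close> by auto
            ultimately show ?thesis using split[of x y] split[of y x] 3 False by auto
          next
            case True
            define T where "T = S - {u}"
            have xT: "x \<in> ?C x" using Cself 3(1) by auto
            have "?C y = ?C x" using True by (rule component_eq)
            then have "S = insert u (?C x)" using cover[OF 3(1)] by simp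
            then have TC: "T = ?C x" using C(1)[of x] by (auto simp: T_def)
            have T: "conn E T" "T \<subseteq> V" "T \<subseteq> S - {u}" "u' \<in> T" "u \<notin> T"
              using less.prems w(6) False C(2)[of x] TC by (auto simp: T_def \<open>u' \<noteq> u\<close>)
            have Tw: "w \<notin> T" "w' \<notin> T" using w T(3) by auto
            have bT: "bd T = {(x, u), (y, u), (u', w')}"
            proof -
              have "N u \<inter> ?C x = {x, y}" using 3 xT True C(1)[of x] by blast
              then show ?thesis using bC[of x] T(4) unfolding TC by auto
            qed
            \<comment> \<open>Here \<open>b\<close> is the far end of the chord from
              \<open>u\<close>. The part \<open>?A\<close> that \<open>b\<close> cuts off from
              \<open>u'\<close> is the chain spanned by the chord, attached by \<open>a u\<close>
              and \<open>p b\<close>.\<close>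
            have chord_case: ?thesis
              if ab: "N u \<inter> S = {a, b}" "a \<noteq> b" "{a, b} = {x, y}" "u' \<notin> component E (T - {b}) a" for a b
            proof -
              let ?A = "component E (T - {b}) a"
              have abT: "a \<in> T" "b \<in> T" "E u a" "E u b" "E b u" "b \<noteq> u" "b \<in> S"
              proof -
                have "{a, b} \<subseteq> ?C x" unfolding ab(3) using xT True by simp
                then show "a \<in> T" "b \<in> T" by (simp_all add: TC)
                then show "b \<noteq> u" "b \<in> S" using T(3) by auto
                show "E u a" "E u b" using ab(1) by auto
                then show "E b u" using sym by simp
              qed
              have bT': "bd T = {(a, u), (b, u), (u', w')}" using bT ab(2,3) by (auto simp: doubleton_eq_iff)
              have A: "?A \<subseteq> T - {b}" "conn E ?A" "a \<in> ?A"
                using component_subset[of E "T - {b}" a] conn_component component_self[of a "T - {b}" E] abT ab(2)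
                by simp_all
              have AS: "?A \<subseteq> S - {u}" "w \<notin> ?A" "w' \<notin> ?A" "u \<notin> ?A" using A(1) T(3,5) Tw by auto
              have "reach E T a b" using T(1) abT by (simp add: conn_def)
              then obtain p where p: "p \<in> ?A" "E b p" using component_adjacent ab(2) by metis
              have N3: "N u = {w, a, b}" using Nu unfolding ab(1) .
              have d: "distinct [w, a, b]" using abT ab(2) Tw by auto
              have Zub: "conn E {u, b}" using conn_insert[OF conn_singleton, of b b u] abT by simp
              have pT: "p \<in> T" using p A by auto
              have bdA: "bd ?A = {(k, b) | k. k \<in> N b \<inter> ?A} \<union> {(a, u)}"
                using component_boundary_eq[OF HOL.refl abT(2), of a] bT' A ab(4) by auto
              have chA: "chain ?A a u p b" "bd ?A = {(a, u), (p, b)}" if "N b \<inter> ?A = {p}"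
              proof -
                show b: "bd ?A = {(a, u), (p, b)}" using bdA that by auto
                show "chain ?A a u p b"
                  by (rule chn[OF AS(1) w(3) A(2) b _ Zub]) (use abT AS A in auto)
              qed
              show ?thesis
              \<comment> \<open>The third edge of \<open>b\<close> is either the far attaching edge,
                which ends the chain, or leads into the component of \<open>u'\<close>, which is the
                rest of the chain.\<close>
              proof (cases "u' = b")
                case True
                have db: "distinct [w', p, u]" using pT Tw T(5) w'u by auto
                have Nb: "N b = {w', p, u}"
                  using w(4) True p abT db by (intro N_eqI) simp_all
                have "N b \<inter> ?A = {p}" "N b \<inter> T = {p}" unfolding Nb using p pT AS Tw T(5) by auto
                moreover have "component E (T - {b}) p = ?A" by (rule component_eq[OF p(1)])
                ultimately have "T = insert b ?A"
                  using component_cover_eq[OF T(1) abT(2), of "{p}"] by simp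
                then have S: "S = insert u (insert b ?A)" using w(3) by (auto simp: T_def)
                have "link (insert u (insert b ?A)) u w b w'"
                  by (rule chord[OF N3 d Nb db]) (use chA AS \<open>N b \<inter> ?A = {p}\<close> in auto)
                then show ?thesis using single S True by metis
              next
                case False
                let ?D = "component E (T - {b}) u'"
                have D: "?D \<subseteq> T - {b}" "conn E ?D" "u' \<in> ?D"
                  using component_subset[of E "T - {b}" u'] conn_component component_self[of u' "T - {b}" E] T(4) False
                  by simp_all
                have disj: "?A \<inter> ?D = {}" by (rule component_disjoint[OF ab(4)])
                have "reach E T u' b" using T(1,4) abT by (simp add: conn_def)
                then obtain q where q: "q \<in> ?D" "E b q" using component_adjacent False by metis
                have qp: "q \<noteq> p" "q \<notin> ?A" "q \<in> T" "p \<notin> ?D" "a \<notin> ?D" using p q disj D(1) A(3) by auto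
                have DS: "?D \<subseteq> S - {u}" "w \<notin> ?D" "w' \<notin> ?D" "u \<notin> ?D" using D(1) T(3,5) Tw by auto
                have db: "distinct [q, p, u]" using pT qp T(5) by auto
                have Nb: "N b = {q, p, u}"
                  using p abT q db by (intro N_eqI) simp_all
                have n: "N b \<inter> ?A = {p}" "N b \<inter> ?D = {q}" "N b \<inter> T = {p, q}"
                  unfolding Nb using p pT AS T(5) q qp DS by auto
                have "component E (T - {b}) p = ?A" "component E (T - {b}) q = ?D"
                  by (rule component_eq[OF p(1)], rule component_eq[OF q(1)])
                then have "T = insert b (?A \<union> ?D)"
                  using component_cover_eq[OF T(1) abT(2) n(3)] by simp
                then have S: "S = insert u (insert b ?A) \<union> ?D" using w(3) by (auto simp: T_def)
                have bdD: "bd ?D = {(q, b), (u', w')}"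
                  using component_boundary_eq[OF HOL.refl abT(2), of u'] bT' D qp(5) n(2) by auto
                have Zb: "conn E (insert b (insert u Z))" by (rule conn_insert[OF Zu, of u]) (use abT in auto)
                have "chain ?D q b u' w'"
                  by (rule chn[OF DS(1) w(3) D(2) bdD _ Zb]) (use DS D(1) abT Z w in auto)
                moreover have "link (insert u (insert b ?A)) u w b q"
                  by (rule chord[OF N3 d Nb db]) (use chA AS n qp in auto)
                ultimately show ?thesis unfolding S
                  by (intro append[of _ u w b q ?D u' w']) (use disj DS AS D q w'u bdD w abT in auto)
              qed
            qed
            have "u' \<notin> component E (T - {x}) y \<or> u' \<notin> component E (T - {y}) x"
              by (rule chord_end[OF tf T(1,2) _ _ 3(2) T(4,5) _ _ w(1) Z(1) _ uZ Z(3,4) w(4)])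
                (use 3 xT True TC Z(2) T(3) in auto)
            then show ?thesis using chord_case[of y x] chord_case[of x y] 3 by auto
          qed
        qed
      qed
    qed
    show ?case using pendant chain by blast
  qed
  then show "bd S = {(u, w)} \<Longrightarrow> pendant S u w"
    and "\<lbrakk>bd S = {(u, w), (u', w')}; (u, w) \<noteq> (u', w'); conn E Z; Z \<inter> S = {}; w \<in> Z; w' \<in> Z\<rbrakk>
      \<Longrightarrow> chain S u w u' w'"
    by blast+
qed

text \<open>The recursion can only bottom out in \<open>leaf\<close> or \<open>vertex\<close>, whose
  vertex has degree one or two. So a set in which all degrees are three contains no piece at
  all.\<close>

lemma low_degree_vertex:
  shows "pendant S u w \<Longrightarrow> \<exists>v\<in>S. card (N v) \<le> 2"
    and "link P a c b d \<Longrightarrow> \<exists>v\<in>P. card (N v) \<le> 2"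
    and "chain T x y x' y' \<Longrightarrow> \<exists>v\<in>T. card (N v) \<le> 2"
  by (induct rule: pendant_link_chain.inducts) auto

lemma card_N_3:
  assumes "\<not> card (N u) \<le> 2"
  obtains x y z where "N u = {x, y, z}" "distinct [x, y, z]"
proof -
  have "card (N u) = 3" using assms degree[of u] by linarith
  then show ?thesis using that unfolding card_3_iff by auto
qed

text \<open>If all degrees are three, every part with one attaching edge, or with two whose outer
  ends are connected outside, contradicts \<open>low_degree_vertex\<close>. This makes the
  neighbours of an arbitrary \<open>u\<close> inseparable in \<open>S - {u}\<close>, absence of
  thetas makes them pairwise adjacent, and then no edge is left to leave the four vertices.\<close>

lemma low_degree_or_K4:
  assumes tf: "theta_free E" and S: "S \<subseteq> V" "conn E S" "bd S = {}" "S \<noteq> {}"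
  obtains v where "v \<in> S" "card (N v) \<le> 2"
  | u x y z where "distinct [u, x, y, z]" "S = {u, x, y, z}" "N u = {x, y, z}" "N x = {u, y, z}"
      "N y = {u, x, z}" "N z = {u, x, y}"
proof (cases "\<exists>v\<in>S. card (N v) \<le> 2")
  case False
  obtain u where u: "u \<in> S" using S(4) by blast
  obtain x y z where xyz: "N u = {x, y, z}" "distinct [x, y, z]" using card_N_3 False u by metis
  have bS: "m \<in> S" if "k \<in> S" "E k m" for k m
    using S(3) that boundary_iff[of k m E S] by auto
  have NS: "N u \<inter> S = {x, y, z}" using bS[OF u] xyz(1) by auto
  let ?C = "component E (S - {u})"
  have C: "?C v \<subseteq> S - {u}" "conn E (?C v)" for v by (rule component_subset, rule conn_component)
  have bC: "bd (?C v) = {(k, u) | k. k \<in> N u \<inter> ?C v}" for v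
    using component_boundary_eq[OF HOL.refl u, of v] S(3) by auto
  have xS: "x \<in> S - {u}" "y \<in> S - {u}" "z \<in> S - {u}" using NS irrefl xyz(1) by auto
  have nopend: "\<not> pendant A v r" and nochain: "\<not> chain A v r v' r'" if "A \<subseteq> S" for A v r v' r'
    using low_degree_vertex(1)[of A v r] low_degree_vertex(3)[of A v r v' r'] False that by blast+
  have lone: "b \<in> ?C a \<or> c \<in> ?C a" if "{a, b, c} = {x, y, z}" for a b c
  proof (rule ccontr)
    assume bc: "\<not> ?thesis"
    have "a \<in> {x, y, z}" using that by auto
    then have "a \<in> ?C a" using xS by (auto intro: component_self)
    then have "N u \<inter> ?C a = {a}" unfolding xyz(1) that[symmetric] using bc by auto
    then have "bd (?C a) = {(a, u)}" using bC[of a] by auto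
    then have "pendant (?C a) a u"
      using pendant_decomposition[OF tf _ C(2)] C(1)[of a] S(1) by blast
    then show False using nopend C(1)[of a] by blast
  qed
  have "y \<in> ?C x \<and> z \<in> ?C x"
  proof -
    have "{y, x, z} = {x, y, z}" "{z, x, y} = {x, y, z}" by auto
    then have "y \<in> ?C x \<or> z \<in> ?C x" "x \<in> ?C y \<or> z \<in> ?C y" "x \<in> ?C z \<or> y \<in> ?C z"
      using lone by simp_all
    then show ?thesis using component_sym component_eq by metis
  qed
  then have Cy: "?C y = ?C x" "?C z = ?C x" using component_eq by metis+
  define T where "T = S - {u}"
  have "S = insert u (?C x)" using component_cover_eq[OF S(2) u NS] Cy by simp
  then have TC: "T = ?C x" unfolding T_def using C(1)[of x] by blast
  have "conn E T" unfolding TC by (rule C(2))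
  then have T: "T = ?C x" "conn E T" "T \<subseteq> S" "T \<subseteq> V" "u \<notin> T" "x \<in> T" "y \<in> T" "z \<in> T"
    using S(1) xS TC by (auto simp: T_def)
  have bT: "m = u \<or> m \<in> T" if "k \<in> T" "E k m" for k m using bS that T_def T(3) by auto
  \<comment> \<open>If \<open>a\<close> separated \<open>b\<close> from \<open>c\<close>, then
    besides its edge to \<open>u\<close> it would have one edge to each side, and the side of
    \<open>b\<close> would be a chain attached to \<open>u\<close> and \<open>a\<close>.\<close>
  have insep: "c \<in> component E (T - {a}) b" if abc: "{a, b, c} = {x, y, z}" "distinct [a, b, c]" for a b c
  proof (rule ccontr)
    assume c: "\<not> ?thesis"
    let ?B = "component E (T - {a}) b" and ?D = "component E (T - {a}) c"
    have "a \<in> {x, y, z}" "b \<in> {x, y, z}" "c \<in> {x, y, z}" using abc(1) by auto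
    then have abcT: "a \<in> T" "b \<in> T" "c \<in> T" using T(6-8) by auto
    have Nu: "N u = {a, b, c}" using xyz(1) abc(1) by simp
    have disj: "?B \<inter> ?D = {}" by (rule component_disjoint[OF c])
    have B: "?B \<subseteq> T - {a}" "conn E ?B" "b \<in> ?B" "?D \<subseteq> T - {a}"
      using component_subset[of E "T - {a}"] conn_component component_self[of b "T - {a}" E] abcT abc(2)
      by (simp_all, blast)
    have "reach E T b a" "reach E T c a" using T(2) abcT by (simp_all add: conn_def)
    then obtain p q where pq: "p \<in> ?B" "E a p" "q \<in> ?D" "E a q"
      using component_adjacent abc(2) by (metis distinct_length_2_or_more)
    have ua: "E a u" using Nu sym by auto
    have d: "distinct [p, q, u]" using pq disj B(1,4) T(5) by auto
    have Na: "N a = {p, q, u}" by (rule N_eqI[OF pq(2,4) ua d])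
    have "bd ?B = {(b, u), (p, a)}"
    proof -
      have "bd T = {(a, u), (b, u), (c, u)}"
        using bC[of x] abcT unfolding T(1)[symmetric] Nu by auto
      moreover have "N a \<inter> ?B = {p}" unfolding Na using pq disj B(1) T(5) by auto
      moreover have "c \<notin> ?B" "a \<notin> ?B" using c B(1) by auto
      ultimately show ?thesis
        using component_boundary_eq[OF HOL.refl abcT(1), of b] B(3) by auto
    qed
    moreover have "conn E {u, a}" using conn_insert[OF conn_singleton, of a a u] Nu by auto
    moreover have "u \<noteq> a" using T(5) abcT by auto
    ultimately have "chain ?B b u p a"
      by (intro chain_decomposition[OF tf _ B(2), where Z = "{u, a}"]) (use B(1) T(4,5) in auto)
    then show False using nochain B(1) T(3) by blast
  qed
  \<comment> \<open>Suppose \<open>a\<close> and \<open>b\<close> are not adjacent. The part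
    \<open>?K\<close> around \<open>c\<close> touches both; a connection from \<open>a\<close> to
    \<open>b\<close> avoiding \<open>c\<close> yields another part \<open>?I\<close>, without
    \<open>a\<close>, \<open>b\<close>, \<open>c\<close>, that touches both. If \<open>?I\<close>
    touches \<open>c\<close>, then \<open>u\<close> and \<open>?I\<close> form a tripod over
    \<open>a\<close>, \<open>b\<close>, \<open>c\<close>; otherwise \<open>a\<close> and
    \<open>b\<close> are joined through \<open>?I\<close>, \<open>{u}\<close> and
    \<open>?K\<close>.\<close>
  have adj: "E a b" if abc: "{a, b, c} = {x, y, z}" "distinct [a, b, c]" for a b c
  proof (rule ccontr)
    assume nab: "\<not> E a b"
    have "a \<in> {x, y, z}" "b \<in> {x, y, z}" "c \<in> {x, y, z}" using abc(1) by auto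
    then have abcT: "a \<in> T" "b \<in> T" "c \<in> T" using T(6-8) by auto
    have Nu: "N u = {a, b, c}" using xyz(1) abc(1) by simp
    have ua: "E u a" "E u b" "E u c" using Nu by auto
    have ne: "a \<noteq> b" "a \<noteq> c" "b \<noteq> c" using abc(2) by auto
    have p1: "{a, c, b} = {x, y, z}" "{b, a, c} = {x, y, z}" "{c, a, b} = {x, y, z}" using abc(1) by auto
    have r1: "reach E (T - {a}) c b" "reach E (T - {b}) c a" "reach E (T - {c}) b a"
      using insep[of a c b] insep[of b c a] insep[of c b a] p1 ne
      by (auto simp: component_def insert_commute)
    let ?K = "component E (T - {a} - {b}) c"
    let ?R = "T - {a} - {b} - {c}"
    have eq: "T - {b} - {a} = T - {a} - {b}" "T - {c} - {a} - {b} = ?R" by blast+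
    obtain kb where kb: "kb \<in> ?K" "E b kb" using component_adjacent[OF r1(1)] ne by metis
    obtain ka where ka: "ka \<in> ?K" "E a ka" using component_adjacent[OF r1(2)] ne eq(1) by metis
    obtain p where p: "p \<in> component E (T - {c} - {a}) b" "E a p" using component_adjacent[OF r1(3)] ne by metis
    have "p \<noteq> b" using nab p(2) by auto
    have "reach E (T - {c} - {a}) p b" using p(1) reach_sym by (auto simp: component_def)
    then obtain q where q: "q \<in> component E ?R p" "E b q"
      using component_adjacent[of "T - {c} - {a}" p b] \<open>p \<noteq> b\<close> eq(2) by metis
    let ?I = "component E ?R p"
    have I: "?I \<subseteq> ?R" "conn E ?I" by (rule component_subset, rule conn_component)
    have K: "?K \<subseteq> T - {a} - {b}" "conn E ?K" by (rule component_subset, rule conn_component)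
    have "p \<in> ?R" using q(1) reach_in by (fastforce simp: component_def)
    then have pI: "p \<in> ?I" by (rule component_self)
    have uI: "u \<notin> ?I" "u \<notin> ?K" "a \<notin> ?I" "b \<notin> ?I" "c \<notin> ?I" "?I \<subseteq> V" "a \<notin> ?K" "b \<notin> ?K"
      using I(1) K(1) T(4,5) by auto
    have una: "u \<noteq> a" "u \<noteq> b" "u \<noteq> c" using T(5) abcT by auto
    show False
    proof (cases "\<exists>k\<in>?I. E k c")
      case True
      have "E p a" "E q b" using p(2) q(2) sym by auto
      then have "\<exists>v\<in>?I. \<exists>k\<in>{a}. E v k" "\<exists>v\<in>?I. \<exists>k\<in>{b}. E v k" "\<exists>v\<in>?I. \<exists>k\<in>{c}. E v k"
        using pI q(1) True by auto
      then show False
        by (intro theta_free_tripod[OF tf I(2) uI(6,1) conn_singleton[of E a] conn_singleton[of E b] conn_singleton[of E c]])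
          (use uI ne una ua in simp_all)
    next
      case nc: False
      have "?I \<inter> ?K = {}"
      proof (rule ccontr)
        assume "?I \<inter> ?K \<noteq> {}"
        then obtain k where k: "k \<in> ?I" "k \<in> ?K" by blast
        have "reach E (T - {a} - {b}) k c" using k(2) reach_sym by (auto simp: component_def)
        moreover have "k \<noteq> c" using k(1) uI by auto
        ultimately obtain l where l: "l \<in> component E ?R k" "E c l" using component_adjacent by metis
        then have "l \<in> ?I" using component_eq[OF k(1)] by simp
        then show False using nc l(2) sym by blast
      qed
      moreover have "\<exists>k\<in>?I. E a k" "\<exists>k\<in>?I. E b k" "\<exists>k\<in>?K. E a k" "\<exists>k\<in>?K. E b k"
        using p pI q ka kb by auto
      moreover have "E a u" "E b u" using ua sym by auto
      ultimately show False
        by (intro theta_freeD[OF tf ne(1) _ _ _ _ _ I(2) conn_singleton[of E u] K(2)])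
          (use uI una in \<open>simp_all add: insert_commute\<close>)
    qed
  qed
  have ex: "E x y" "E x z" "E y z" "E y x" "E z x" "E z y" "E x u" "E y u" "E z u"
    using adj[of x y z] adj[of x z y] adj[of y z x] xyz sym by (auto simp: insert_commute)
  have un: "u \<noteq> x" "u \<noteq> y" "u \<noteq> z" using xS by auto
  have Nx: "N x = {u, y, z}" "N y = {u, x, z}" "N z = {u, x, y}"
    using ex un xyz(2) by (intro N_eqI; auto)+
  have K: "N v \<subseteq> {u, x, y, z}" if "v \<in> {u, x, y, z}" for v
    using that by (elim insertE) (simp_all add: xyz(1) Nx)
  have "v \<in> {u, x, y, z}" if "reach E S r v" "r \<in> {u, x, y, z}" for r v
    using that by (induction rule: reach.induct) (use K in blast)+
  then have "S \<subseteq> {u, x, y, z}" using S(2) u unfolding conn_def by blast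
  then have "S = {u, x, y, z}" using u xS by auto
  then show ?thesis using that(2)[of u x y z] xyz Nx un by simp
qed (use that(1) in blast)

end

section \<open>Labels and achievable states\<close>

text \<open>A crumby coloring in which all red components are stars: \<open>Bl\<close> is a blue vertex, \<open>Ctr\<close> the center
  and \<open>Lf\<close> a leaf of a red star (one end of a single red edge counts as its center). These
  conditions only involve the labels of the neighbours.\<close>

datatype label = Bl | Ctr | Lf

fun none :: "label \<Rightarrow> label list \<Rightarrow> bool" where
  "none l [] = True"
| "none l (k # ks) = (if l = k then False else none l ks)"

fun at_most_one :: "label \<Rightarrow> label list \<Rightarrow> bool" where
  "at_most_one l [] = True"
| "at_most_one l (k # ks) = (if l = k then none l ks else at_most_one l ks)"

fun exactly_one :: "label \<Rightarrow> label list \<Rightarrow> bool" where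
  "exactly_one l [] = False"
| "exactly_one l (k # ks) = (if l = k then none l ks else exactly_one l ks)"

fun ok :: "label \<Rightarrow> label list \<Rightarrow> bool" where
  "ok Bl ks = at_most_one Bl ks"
| "ok Ctr ks = (none Ctr ks \<and> \<not> none Lf ks)"
| "ok Lf ks = (none Lf ks \<and> exactly_one Ctr ks)"

text \<open>The state of an attaching edge is the pair of labels of its ends: for a pendant piece the outer
  end comes first, for a link or chain the edges are read from left to right. The pairs \<open>CC\<close> and
  \<open>LL\<close> cannot occur.\<close>

datatype state = BB | BC | BL | CB | CL | LB | LC

fun src :: "state \<Rightarrow> label" where
  "src BB = Bl" | "src BC = Bl" | "src BL = Bl" | "src CB = Ctr" | "src CL = Ctr" | "src LB = Lf" | "src LC = Lf"

fun dst :: "state \<Rightarrow> label" where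
  "dst BB = Bl" | "dst BC = Ctr" | "dst BL = Lf" | "dst CB = Bl" | "dst CL = Lf" | "dst LB = Bl" | "dst LC = Ctr"

definition states :: "state list" where
  "states = [BB, BC, BL, CB, CL, LB, LC]"

text \<open>One entry per state, in the order of \<open>states\<close>. Sets of states
  (\<open>bool row\<close>) and relations between states (\<open>bool row row\<close>) become
  explicit constructor terms, on which the closure conditions can be evaluated.\<close>

datatype 'a row = Row 'a 'a 'a 'a 'a 'a 'a

fun get :: "'a row \<Rightarrow> state \<Rightarrow> 'a" where
  "get (Row a b c d e f g) BB = a"
| "get (Row a b c d e f g) BC = b"
| "get (Row a b c d e f g) BL = c"
| "get (Row a b c d e f g) CB = d"
| "get (Row a b c d e f g) CL = e"
| "get (Row a b c d e f g) LB = f"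
| "get (Row a b c d e f g) LC = g"

fun join :: "bool row \<Rightarrow> bool row \<Rightarrow> bool row" where
  "join (Row a b c d e f g) (Row a' b' c' d' e' f' g') =
    Row (a \<or> a') (b \<or> b') (c \<or> c') (d \<or> d') (e \<or> e') (f \<or> f') (g \<or> g')"

fun select :: "bool \<Rightarrow> bool row \<Rightarrow> bool row" where
  "select True r = r"
| "select False r = Row False False False False False False False"

fun image_row :: "bool row row \<Rightarrow> bool row \<Rightarrow> bool row" where
  "image_row (Row p q r s t u v) (Row a b c d e f g) =
    join (select a p) (join (select b q) (join (select c r) (join (select d s)
      (join (select e t) (join (select f u) (select g v))))))"

fun compose :: "bool row row \<Rightarrow> bool row row \<Rightarrow> bool row row" where
  "compose (Row a b c d e f g) M = Row (image_row M a) (image_row M b) (image_row M c) (image_row M d)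
    (image_row M e) (image_row M f) (image_row M g)"

fun row_le :: "bool row \<Rightarrow> bool row \<Rightarrow> bool" where
  "row_le (Row a b c d e f g) (Row a' b' c' d' e' f' g') \<longleftrightarrow>
    (a \<longrightarrow> a') \<and> (b \<longrightarrow> b') \<and> (c \<longrightarrow> c') \<and> (d \<longrightarrow> d') \<and> (e \<longrightarrow> e') \<and> (f \<longrightarrow> f') \<and> (g \<longrightarrow> g')"

fun rel_le :: "bool row row \<Rightarrow> bool row row \<Rightarrow> bool" where
  "rel_le (Row a b c d e f g) (Row a' b' c' d' e' f' g') \<longleftrightarrow>
    row_le a a' \<and> row_le b b' \<and> row_le c c' \<and> row_le d d' \<and> row_le e e' \<and> row_le f f' \<and> row_le g g'"

text \<open>The families below were found by computer: iterate the operations on pieces, starting from a leaf and a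
  vertex, keep the minimal sets of achievable states, and then shrink the outcome by replacing members
  by their intersections as long as every graph can still be completed. A row of a relation belongs
  to the left state, the entries of a row to the right state, both in the order of \<^const>\<open>states\<close>.\<close>

context
begin

private abbreviation (input) I :: bool where "I \<equiv> True"
private abbreviation (input) Z :: bool where "Z \<equiv> False"

definition pendant_sets :: "bool row list" where
  "pendant_sets =
   [Row Z Z I I Z I Z,
    Row Z Z I Z I Z I,
    Row I I Z I Z I I,
    Row I Z Z I I I I]"

definition vertex_links :: "bool row row list" where
  "vertex_links =
   [Row (Row Z Z Z Z Z Z Z) (Row Z Z Z I I Z Z) (Row Z Z Z Z Z I I) (Row Z I I Z Z Z Z) (Row Z Z Z Z Z I Z) (Row Z I I Z Z Z Z) (Row Z Z Z I I Z Z),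
    Row (Row Z I I Z Z Z Z) (Row Z Z Z Z I Z Z) (Row Z Z Z Z Z Z I) (Row I I I Z Z Z Z) (Row Z Z Z Z Z I Z) (Row I I I Z Z Z Z) (Row Z Z Z I I Z Z),
    Row (Row Z I I Z Z Z Z) (Row Z Z Z I I Z Z) (Row Z Z Z Z Z I Z) (Row I I I Z Z Z Z) (Row Z Z Z Z Z Z Z) (Row I I I Z Z Z Z) (Row Z Z Z I I Z Z)]"

definition chord_links :: "bool row row list" where
  "chord_links =
   [Row (Row Z Z Z Z Z Z Z) (Row Z Z Z Z Z I Z) (Row Z I I I I Z Z) (Row Z Z Z Z I I I) (Row Z I I Z Z Z Z) (Row Z Z Z Z I I I) (Row Z I I Z Z I Z),
    Row (Row Z Z Z Z I I I) (Row Z I I Z Z I Z) (Row Z I I Z Z Z Z) (Row Z Z Z Z I I I) (Row Z Z Z Z Z Z Z) (Row Z Z Z Z I I I) (Row Z I I Z Z I Z),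
    Row (Row Z Z Z Z I I I) (Row Z Z Z Z Z I Z) (Row Z Z Z I I Z Z) (Row Z Z Z Z I I I) (Row Z I I Z Z Z Z) (Row Z Z Z Z I I I) (Row Z I I Z Z I Z),
    Row (Row Z Z Z Z I Z I) (Row Z Z Z Z Z Z Z) (Row Z I I I I Z Z) (Row Z Z Z Z I I I) (Row I I I Z Z Z Z) (Row Z Z Z Z I I I) (Row I I I Z Z Z Z),
    Row (Row Z Z Z Z Z Z Z) (Row I I I Z Z I Z) (Row I I I I I Z Z) (Row Z Z Z Z I Z I) (Row I I I Z Z Z Z) (Row Z Z Z Z I Z I) (Row I I I Z Z I Z),
    Row (Row Z Z Z Z I Z I) (Row Z Z Z Z Z I Z) (Row Z Z Z I I Z Z) (Row Z I I Z I Z I) (Row I I I Z Z Z Z) (Row Z I I Z I Z I) (Row I I I Z Z I Z),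
    Row (Row Z Z Z Z Z I Z) (Row Z I I Z Z I Z) (Row Z I I I I Z Z) (Row Z I I Z Z I Z) (Row I I I Z Z Z Z) (Row Z I I Z Z I Z) (Row I I I Z Z I Z),
    Row (Row Z Z Z Z I Z I) (Row Z Z Z Z Z I Z) (Row I I I I I Z Z) (Row Z I I I I I I) (Row Z Z Z Z Z Z Z) (Row Z I I I I I I) (Row Z Z Z Z Z I Z),
    Row (Row Z Z Z Z Z I Z) (Row Z I I Z Z I Z) (Row I I I I I Z Z) (Row Z I I I I I Z) (Row Z Z Z Z Z Z Z) (Row Z I I I I I Z) (Row Z I I Z Z I Z),
    Row (Row Z Z Z Z I Z I) (Row I I I Z Z I Z) (Row I I I Z Z Z Z) (Row Z Z Z Z I I I) (Row I I I Z Z Z Z) (Row Z Z Z Z I I I) (Row I I I Z Z I Z),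
    Row (Row Z Z Z Z I I I) (Row Z Z Z Z Z Z Z) (Row I I I Z Z Z Z) (Row Z I I Z I I I) (Row I I I Z Z Z Z) (Row Z I I Z I I I) (Row I I I Z Z Z Z),
    Row (Row Z Z Z Z I I I) (Row I I I Z Z Z Z) (Row I I I Z Z Z Z) (Row Z I I Z I I I) (Row Z Z Z Z Z Z Z) (Row Z I I Z I I I) (Row I I I Z Z Z Z),
    Row (Row Z Z Z Z Z I Z) (Row Z Z Z Z Z I Z) (Row I I I I I Z Z) (Row Z I I I I I Z) (Row I I I Z Z Z Z) (Row Z I I I I I Z) (Row I I I Z Z I Z),
    Row (Row Z Z Z I I I I) (Row Z Z Z Z Z I Z) (Row Z I I Z Z Z Z) (Row Z I I I I I I) (Row I I I Z Z Z Z) (Row Z I I I I I I) (Row I I I Z Z I Z)]"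

definition long_chains :: "bool row row list" where
  "long_chains =
   [Row (Row Z Z Z Z Z Z Z) (Row Z Z Z Z Z Z Z) (Row Z I I Z Z I Z) (Row Z I I Z I I Z) (Row Z Z Z Z Z Z Z) (Row Z I I Z I I Z) (Row Z Z Z Z Z Z Z),
    Row (Row I I I Z I Z Z) (Row Z Z Z Z Z Z Z) (Row Z Z Z Z Z Z Z) (Row I I I Z I Z Z) (Row Z Z Z Z Z Z Z) (Row I I I Z I Z Z) (Row I I I Z I Z Z),
    Row (Row Z I I Z I I Z) (Row Z Z Z Z Z Z Z) (Row Z Z Z Z Z Z Z) (Row Z I I Z I I Z) (Row Z Z Z Z Z Z Z) (Row Z I I Z I I Z) (Row Z Z Z Z I I Z),
    Row (Row Z Z Z Z Z Z Z) (Row Z Z Z Z Z I Z) (Row Z I I Z Z Z Z) (Row Z I I Z Z I Z) (Row Z Z Z Z Z Z Z) (Row Z I I Z Z I Z) (Row Z I I Z Z I Z),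
    Row (Row Z Z Z Z Z Z Z) (Row Z I I Z I I Z) (Row Z I I Z I I Z) (Row Z Z Z Z Z Z Z) (Row Z I I Z Z I Z) (Row Z Z Z Z Z Z Z) (Row Z I I Z I I Z),
    Row (Row Z Z Z Z Z Z Z) (Row Z Z Z Z Z Z Z) (Row I I I Z I Z Z) (Row Z Z Z Z I Z Z) (Row I I I Z Z Z Z) (Row Z Z Z Z I Z Z) (Row I I I Z Z Z Z),
    Row (Row Z Z Z Z Z Z Z) (Row Z Z Z Z I I I) (Row Z Z Z Z I I I) (Row Z I I Z Z I Z) (Row Z Z Z Z Z Z Z) (Row Z I I Z Z I Z) (Row Z Z Z Z I I I),
    Row (Row Z Z Z Z I I Z) (Row Z Z Z Z Z Z Z) (Row I I I Z Z Z Z) (Row Z I I Z I I Z) (Row Z Z Z Z Z Z Z) (Row Z I I Z I I Z) (Row I I I Z Z Z Z),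
    Row (Row Z Z Z Z Z Z Z) (Row Z Z Z Z I Z Z) (Row Z I I Z I I Z) (Row I I I Z Z Z Z) (Row Z Z Z Z Z Z Z) (Row I I I Z Z Z Z) (Row Z Z Z Z I I Z),
    Row (Row Z Z Z Z Z Z Z) (Row Z Z Z Z Z Z Z) (Row Z I I Z I I Z) (Row Z Z Z Z I I Z) (Row Z Z Z Z Z Z Z) (Row Z Z Z Z I I Z) (Row Z I I Z Z I Z),
    Row (Row Z Z Z Z Z Z Z) (Row I I I Z I Z Z) (Row Z Z Z Z Z Z Z) (Row I I I Z I Z Z) (Row Z Z Z Z Z Z Z) (Row I I I Z I Z Z) (Row I I I Z I Z Z),
    Row (Row I I I Z Z I Z) (Row Z Z Z Z Z Z Z) (Row Z I I Z I Z I) (Row I I I Z I I I) (Row Z Z Z Z Z Z Z) (Row I I I Z I I I) (Row Z I I Z I Z I),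
    Row (Row Z Z Z Z I I Z) (Row Z I I Z Z Z Z) (Row Z Z Z Z Z Z Z) (Row Z Z Z Z I I I) (Row Z Z Z Z Z Z Z) (Row Z Z Z Z I I I) (Row Z I I Z Z I Z),
    Row (Row Z Z Z Z Z Z Z) (Row Z Z Z Z Z Z Z) (Row I I I Z Z Z Z) (Row Z I I I I Z Z) (Row Z Z Z Z I I Z) (Row Z I I I I Z Z) (Row Z I I Z I I Z),
    Row (Row Z I I Z Z Z Z) (Row Z Z Z Z Z Z Z) (Row Z I I Z Z I Z) (Row Z I I Z Z I Z) (Row Z I I Z Z I Z) (Row Z I I Z Z I Z) (Row Z I I Z Z I Z),
    Row (Row Z Z Z Z Z Z Z) (Row Z Z Z Z Z Z Z) (Row Z Z Z Z I I Z) (Row Z I I Z I I Z) (Row Z I I Z I I Z) (Row Z I I Z I I Z) (Row Z I I Z I I Z),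
    Row (Row Z I I Z I I Z) (Row Z Z Z Z Z Z Z) (Row Z Z Z Z Z Z Z) (Row Z I I Z I I Z) (Row Z Z Z Z Z Z Z) (Row Z I I Z I I Z) (Row Z I I Z Z I Z),
    Row (Row Z Z Z Z Z Z Z) (Row Z Z Z Z Z I Z) (Row Z I I Z I Z Z) (Row Z Z Z Z I I I) (Row Z Z Z Z Z Z Z) (Row Z Z Z Z I I I) (Row Z Z Z Z Z I Z),
    Row (Row I I I Z Z Z Z) (Row Z Z Z Z Z Z Z) (Row I I I Z I Z Z) (Row I I I Z I Z Z) (Row Z Z Z Z Z Z Z) (Row I I I Z I Z Z) (Row Z Z Z Z Z Z Z),
    Row (Row Z Z Z I I I Z) (Row I I I Z Z Z Z) (Row Z I I Z Z Z Z) (Row Z Z Z I I I I) (Row Z Z Z Z Z Z Z) (Row Z Z Z I I I I) (Row I I I Z I Z I),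
    Row (Row Z Z Z Z Z Z Z) (Row Z I I Z I Z Z) (Row I I I Z I Z Z) (Row Z Z Z Z Z Z Z) (Row I I I Z I Z Z) (Row Z Z Z Z Z Z Z) (Row I I I Z I Z Z),
    Row (Row Z I I Z Z Z Z) (Row Z Z Z Z Z Z Z) (Row Z Z Z I I I Z) (Row I I I I I Z Z) (Row Z Z Z Z Z Z Z) (Row I I I I I Z Z) (Row Z I I I I Z Z),
    Row (Row Z Z Z I I Z Z) (Row I I I Z Z Z Z) (Row I I I Z Z Z Z) (Row Z Z Z I I I Z) (Row Z I I I I I Z) (Row Z Z Z I I I Z) (Row I I I I I I Z),
    Row (Row Z I I Z Z I Z) (Row Z Z Z Z Z Z Z) (Row Z Z Z Z Z Z Z) (Row Z I I Z Z I Z) (Row Z I I Z I I Z) (Row Z I I Z Z I Z) (Row Z I I Z I I Z),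
    Row (Row Z Z Z I I I Z) (Row Z Z Z Z Z Z Z) (Row Z Z Z I I Z Z) (Row Z I I I I I Z) (Row I I I Z Z Z Z) (Row Z I I I I I Z) (Row I I I Z Z Z Z),
    Row (Row Z Z Z Z I Z I) (Row I I I Z Z I Z) (Row I I I Z Z Z Z) (Row Z I I Z I Z I) (Row Z Z Z Z Z Z Z) (Row Z I I Z I Z I) (Row I I I Z Z I Z),
    Row (Row Z Z Z Z Z Z Z) (Row I I I Z I Z I) (Row I I I Z I I I) (Row Z Z Z I I I Z) (Row Z I I Z I Z I) (Row Z Z Z I I I Z) (Row I I I Z I Z I),
    Row (Row Z Z Z Z I I I) (Row Z Z Z Z Z Z Z) (Row Z Z Z Z I I I) (Row Z Z Z Z I I I) (Row Z I I Z Z I Z) (Row Z Z Z Z I I I) (Row Z I I Z Z I Z),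
    Row (Row Z Z Z Z Z Z Z) (Row Z I I Z Z Z Z) (Row Z I I Z I I Z) (Row Z I I Z Z I Z) (Row Z Z Z Z Z Z Z) (Row Z I I Z Z I Z) (Row Z I I Z Z Z Z),
    Row (Row I I I Z Z Z Z) (Row Z Z Z Z Z Z Z) (Row Z Z Z Z Z Z Z) (Row I I I Z I I Z) (Row Z I I Z I I Z) (Row I I I Z I I Z) (Row Z I I Z I I Z),
    Row (Row I I I Z Z Z Z) (Row Z I I I I I Z) (Row Z I I I I Z Z) (Row I I I Z Z Z Z) (Row Z Z Z Z Z Z Z) (Row I I I Z Z Z Z) (Row Z I I I I I Z),
    Row (Row Z Z Z Z I Z Z) (Row Z Z Z Z Z Z Z) (Row Z I I Z I Z I) (Row I I I Z I I Z) (Row Z I I Z I Z I) (Row I I I Z I I Z) (Row I I I Z I Z I),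
    Row (Row Z I I I I Z Z) (Row I I I Z I I I) (Row Z Z Z Z I I I) (Row Z I I I I Z I) (Row Z Z Z Z Z Z Z) (Row Z I I I I Z I) (Row I I I Z I I I),
    Row (Row Z I I Z I I Z) (Row Z Z Z Z Z Z Z) (Row Z Z Z Z I I Z) (Row Z I I Z I I Z) (Row I I I Z Z Z Z) (Row Z I I Z I I Z) (Row I I I Z Z Z Z),
    Row (Row Z Z Z Z Z Z Z) (Row Z Z Z Z I I I) (Row Z I I Z I I I) (Row Z I I Z Z Z Z) (Row Z Z Z Z I I I) (Row Z I I Z Z Z Z) (Row Z Z Z Z I I I),
    Row (Row Z Z Z Z I Z I) (Row Z Z Z Z Z I Z) (Row Z Z Z I I Z Z) (Row Z I I Z I Z I) (Row I I I Z Z Z Z) (Row Z I I Z I Z I) (Row I I I Z Z I Z),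
    Row (Row Z Z Z Z I I I) (Row Z Z Z Z Z I Z) (Row Z Z Z I I Z Z) (Row Z Z Z Z I I I) (Row Z I I Z Z Z Z) (Row Z Z Z Z I I I) (Row Z I I Z Z I Z),
    Row (Row Z Z Z Z I Z I) (Row Z Z Z Z Z I Z) (Row Z I I Z Z Z Z) (Row Z Z Z Z I I I) (Row I I I Z Z Z Z) (Row Z Z Z Z I I I) (Row I I I Z Z I Z),
    Row (Row Z Z Z Z I Z I) (Row Z Z Z Z Z Z Z) (Row Z I I I I Z Z) (Row Z Z Z Z I I I) (Row I I I Z Z Z Z) (Row Z Z Z Z I I I) (Row I I I Z Z Z Z)]"

end

definition links :: "bool row row list" where
  "links = vertex_links @ chord_links"

text \<open>\<open>chord_links\<close> are not repeated here because \<open>check_chord_long\<close>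
  puts a member of \<open>long_chains\<close> below each of them. Chains with equal ends stay
  separate: a chain that closes up at one outer vertex has two different ends, so cycles only meet
  \<open>long_chains\<close>.\<close>

definition chains :: "bool row row list" where
  "chains = vertex_links @ long_chains"

section \<open>Rows read as sets and relations, and the finite checks\<close>

lemma in_states: "e \<in> set states"
  by (cases e) (simp_all add: states_def)

lemma all_states: "list_all P states \<longleftrightarrow> (\<forall>e. P e)"
  using in_states by (auto simp: list_all_iff)

lemma ex_states: "list_ex P states \<longleftrightarrow> (\<exists>e. P e)"
  using in_states by (auto simp: list_ex_iff)

lemma get_image_row: "get (image_row M r) f \<longleftrightarrow> (\<exists>h. get r h \<and> get (get M h) f)"
proof -
  have s: "get (select b v) f \<longleftrightarrow> b \<and> get v f" for b v by (cases b; cases f) simp_all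
  have j: "get (join v v') f \<longleftrightarrow> get v f \<or> get v' f" for v v' by (cases v; cases v'; cases f) simp_all
  obtain a b c d e g h where r: "r = Row a b c d e g h" by (cases r)
  obtain a' b' c' d' e' g' h' where M: "M = Row a' b' c' d' e' g' h'" by (cases M)
  show ?thesis unfolding ex_states[symmetric] states_def r M by (simp add: s j)
qed

lemma get_compose: "get (get (compose M M') e) f \<longleftrightarrow> (\<exists>h. get (get M e) h \<and> get (get M' h) f)"
  by (cases M; cases e) (simp_all add: get_image_row)

lemma get_row_le: "row_le v v' \<Longrightarrow> get v e \<Longrightarrow> get v' e"
  by (cases v; cases v'; cases e) simp_all

lemma get_rel_le: "rel_le M M' \<Longrightarrow> get (get M e) f \<Longrightarrow> get (get M' e) f"
  by (cases M; cases M'; cases e) (auto intro: get_row_le)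

text \<open>The checks up to \<open>check_append\<close> express closure: whatever listed bounds the
  parts have, some listed bound lies below what the operation yields. One implication from
  \<open>get\<close> suffices, since only lower bounds are claimed.\<close>

lemma check_leaf: "list_ex (\<lambda>D. list_all (\<lambda>e. get D e \<longrightarrow> ok (dst e) [src e]) states) pendant_sets"
  by code_simp

lemma check_one_child: "list_all (\<lambda>D. list_ex (\<lambda>D'. list_all (\<lambda>e. get D' e \<longrightarrow>
    list_ex (\<lambda>d. get D d \<and> src d = dst e \<and> ok (dst e) [src e, dst d]) states) states)
    pendant_sets) pendant_sets"
  by code_simp

lemma check_two_children: "list_all (\<lambda>D. list_all (\<lambda>D'. list_ex (\<lambda>D''. list_all (\<lambda>e. get D'' e \<longrightarrow>
    list_ex (\<lambda>d. get D d \<and> src d = dst e \<and>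
      list_ex (\<lambda>d'. get D' d' \<and> src d' = dst e \<and> ok (dst e) [src e, dst d, dst d']) states) states) states)
    pendant_sets) pendant_sets) pendant_sets"
  by code_simp

text \<open>Both outer ends of the chain are the vertex closing the cycle, labelled
  \<open>dst e\<close>. Read from left to right, it is the source of the first edge \<open>d\<close>
  and the target of the last edge \<open>d'\<close>, so its inner neighbours are labelled
  \<open>dst d\<close> and \<open>src d'\<close>.\<close>

lemma check_cycle: "list_all (\<lambda>M. list_ex (\<lambda>D. list_all (\<lambda>e. get D e \<longrightarrow>
    list_ex (\<lambda>d. src d = dst e \<and> list_ex (\<lambda>d'. dst d' = dst e \<and> get (get M d) d' \<and>
      ok (dst e) [src e, dst d, src d']) states) states) states) pendant_sets) long_chains"
  by code_simp

lemma check_vertex: "list_ex (\<lambda>M. list_all (\<lambda>e. list_all (\<lambda>f. get (get M e) f \<longrightarrow>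
    dst e = src f \<and> ok (dst e) [src e, dst f]) states) states) vertex_links"
  by code_simp

lemma check_vertex_pendant: "list_all (\<lambda>D. list_ex (\<lambda>M. list_all (\<lambda>e. list_all (\<lambda>f. get (get M e) f \<longrightarrow>
    dst e = src f \<and> list_ex (\<lambda>d. get D d \<and> src d = dst e \<and> ok (dst e) [src e, dst d, dst f]) states)
    states) states) vertex_links) pendant_sets"
  by code_simp

text \<open>The chord needs no state of its own: its ends carry \<open>dst e\<close> and
  \<open>src f\<close>, and each is listed among the neighbours of the other. The same two labels
  are the outer labels of the spanned chain.\<close>

lemma check_chord: "list_all (\<lambda>M. list_ex (\<lambda>M'. list_all (\<lambda>e. list_all (\<lambda>f. get (get M' e) f \<longrightarrow>
    list_ex (\<lambda>d. src d = dst e \<and> ok (dst e) [src e, dst d, src f] \<and>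
      list_ex (\<lambda>d'. dst d' = src f \<and> get (get M d) d' \<and> ok (src f) [dst f, src d', dst e]) states) states)
    states) states) chord_links) chains"
  by code_simp

lemma check_chord_long: "list_all (\<lambda>M. list_ex (\<lambda>M'. rel_le M' M) long_chains) chord_links"
  by code_simp

lemma check_append:
  "list_all (\<lambda>M. list_all (\<lambda>M'. list_ex (\<lambda>M''. rel_le M'' (compose M M')) long_chains) chains) links"
  by code_simp

text \<open>At the final vertex no outer edge constrains the label, so one choice of states that
  satisfies this vertex is enough.\<close>

lemma check_root_one: "list_all (\<lambda>D. list_ex (\<lambda>d. get D d \<and> ok (src d) [dst d]) states) pendant_sets"
  by code_simp

lemma check_root_two: "list_all (\<lambda>D. list_all (\<lambda>D'. list_ex (\<lambda>d. get D d \<and> list_ex (\<lambda>d'. get D' d' \<and>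
    src d' = src d \<and> ok (src d) [dst d, dst d']) states) states) pendant_sets) pendant_sets"
  by code_simp

lemma check_root_cycle: "list_all (\<lambda>M. list_ex (\<lambda>d. list_ex (\<lambda>d'. dst d' = src d \<and> get (get M d) d' \<and>
    ok (src d) [dst d, src d']) states) states) long_chains"
  by code_simp

lemmas leaf_closed = check_leaf[unfolded all_states ex_states, unfolded list_all_iff list_ex_iff]
lemmas one_child_closed = check_one_child[unfolded all_states ex_states, unfolded list_all_iff list_ex_iff]
lemmas two_children_closed = check_two_children[unfolded all_states ex_states, unfolded list_all_iff list_ex_iff]
lemmas cycle_closed = check_cycle[unfolded all_states ex_states, unfolded list_all_iff list_ex_iff]
lemmas vertex_closed = check_vertex[unfolded all_states ex_states, unfolded list_all_iff list_ex_iff]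
lemmas vertex_pendant_closed = check_vertex_pendant[unfolded all_states ex_states, unfolded list_all_iff list_ex_iff]
lemmas chord_closed = check_chord[unfolded all_states ex_states, unfolded list_all_iff list_ex_iff]
lemmas chord_long_closed = check_chord_long[unfolded all_states ex_states, unfolded list_all_iff list_ex_iff]
lemmas append_closed = check_append[unfolded all_states ex_states, unfolded list_all_iff list_ex_iff]
lemmas root_one_closed = check_root_one[unfolded all_states ex_states, unfolded list_all_iff list_ex_iff]
lemmas root_two_closed = check_root_two[unfolded all_states ex_states, unfolded list_all_iff list_ex_iff]
lemmas root_cycle_closed = check_root_cycle[unfolded all_states ex_states, unfolded list_all_iff list_ex_iff]

section \<open>Extending labellings over pieces\<close>

context subcubic_graph
begin

text \<open>\<open>ok\<close> only counts labels, so the order of the neighbours is immaterial; the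
  existential lets each construction supply its own enumeration.\<close>

definition fits :: "('a \<Rightarrow> label) \<Rightarrow> 'a \<Rightarrow> bool" where
  "fits c v \<longleftrightarrow> (\<exists>ns. distinct ns \<and> set ns = N v \<and> ok (c v) (map c ns))"

lemma fitsI: "N v = set ns \<Longrightarrow> distinct ns \<Longrightarrow> ok (c v) (map c ns) \<Longrightarrow> fits c v"
  unfolding fits_def by metis

lemma fits_cong:
  assumes "fits c v" "c' v = c v" "\<And>k. E v k \<Longrightarrow> c' k = c k"
  shows "fits c' v"
proof -
  obtain ns where ns: "distinct ns" "set ns = N v" "ok (c v) (map c ns)"
    using assms(1) by (auto simp: fits_def)
  then have "map c' ns = map c ns" using assms(3) by auto
  then show ?thesis using ns assms(2) unfolding fits_def by metis
qed

definition extends :: "'a set \<Rightarrow> ('a \<Rightarrow> label) \<Rightarrow> ('a \<Rightarrow> label) \<Rightarrow> bool" where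
  "extends S c0 c \<longleftrightarrow> (\<forall>v. v \<notin> S \<longrightarrow> c v = c0 v) \<and> (\<forall>v\<in>S. fits c v)"

text \<open>A lower bound only: \<open>D\<close> may omit states that extend too. Outside
  \<open>S\<close> only the label of \<open>w\<close> is prescribed, and \<open>w\<close> itself
  need not fit, so its condition can be verified after all pieces around it are labelled.\<close>

definition realizes1 :: "bool row \<Rightarrow> 'a set \<Rightarrow> 'a \<Rightarrow> 'a \<Rightarrow> bool" where
  "realizes1 D S u w \<longleftrightarrow>
    (\<forall>e c0. get D e \<longrightarrow> c0 w = src e \<longrightarrow> (\<exists>c. extends S c0 c \<and> c u = dst e))"

definition realizes2 :: "bool row row \<Rightarrow> 'a set \<Rightarrow> 'a \<Rightarrow> 'a \<Rightarrow> 'a \<Rightarrow> 'a \<Rightarrow> bool" where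
  "realizes2 M S u w u' w' \<longleftrightarrow>
    (\<forall>e f c0. get (get M e) f \<longrightarrow> c0 w = src e \<longrightarrow> c0 w' = dst f \<longrightarrow>
      (\<exists>c. extends S c0 c \<and> c u = dst e \<and> c u' = src f))"

lemma realizes2_mono: "realizes2 M S u w u' w' \<Longrightarrow> rel_le M' M \<Longrightarrow> realizes2 M' S u w u' w'"
  unfolding realizes2_def using get_rel_le by blast

lemma extends_outside: "extends S c0 c \<Longrightarrow> v \<notin> S \<Longrightarrow> c v = c0 v"
  by (simp add: extends_def)

lemma fits_after:
  assumes "extends S c0 c" "v \<in> S" "\<And>k. k \<in> S \<Longrightarrow> c' k = c k" "\<And>k m. (k, m) \<in> bd S \<Longrightarrow> c' m = c m"
  shows "fits c' v"
proof (rule fits_cong)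
  show "fits c v" using assms(1,2) by (simp add: extends_def)
  show "c' v = c v" using assms(2,3) by simp
  show "c' k = c k" if "E v k" for k
    using assms(2,3) assms(4)[of v k] that by (cases "k \<in> S") (auto simp: boundary_iff)
qed

text \<open>The label of \<open>u\<close> is fixed in advance, the piece is extended around it, and
  only then is the condition at \<open>u\<close> verified.\<close>

lemma extends_insert:
  assumes "extends S (c0(u := l)) c" "c u = l" "N u = set ns" "distinct ns" "ok l (map c ns)"
  shows "extends (insert u S) c0 c"
  using assms fitsI[of u ns c] by (auto simp: extends_def)

lemma realizes1_leaf:
  assumes "N u = {w}" "w \<noteq> u" "\<forall>e. get D e \<longrightarrow> ok (dst e) [src e]"
  shows "realizes1 D {u} u w"
  unfolding realizes1_def
proof (intro allI impI)
  fix e c0 assume e: "get D e" "c0 w = src e"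
  have "extends {u} c0 (c0(u := dst e))"
    using fitsI[of u "[w]" "c0(u := dst e)"] assms e by (auto simp: extends_def)
  then show "\<exists>c. extends {u} c0 c \<and> c u = dst e" by (metis fun_upd_same)
qed

lemma realizes1_one_child:
  assumes N: "N u = {w, x}" "distinct [w, x]" and T: "realizes1 D T x u" "u \<notin> T" "w \<notin> T" "x \<in> T"
    and D': "\<forall>e. get D' e \<longrightarrow> (\<exists>d. get D d \<and> src d = dst e \<and> ok (dst e) [src e, dst d])"
  shows "realizes1 D' (insert u T) u w"
  unfolding realizes1_def
proof (intro allI impI)
  fix e c0 assume e: "get D' e" "c0 w = src e"
  have wu: "w \<noteq> u" using N(1) irrefl by auto
  obtain d where d: "get D d" "src d = dst e" "ok (dst e) [src e, dst d]" using D' e(1) by blast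
  obtain c where c: "extends T (c0(u := dst e)) c" "c x = dst d"
    using T(1) d unfolding realizes1_def by (metis fun_upd_same)
  have cu: "c u = dst e" "c w = src e" using extends_outside[OF c(1)] T wu e by auto
  have "extends (insert u T) c0 c"
    by (rule extends_insert[OF c(1) cu(1), of "[w, x]"]) (use N c cu d in auto)
  then show "\<exists>c. extends (insert u T) c0 c \<and> c u = dst e" using cu by blast
qed

text \<open>The sets are labelled one after the other; the conditions on \<open>S\<close> survive
  the second step because no attaching edge of \<open>S\<close> ends in \<open>T\<close>.\<close>

lemma extends_Un:
  assumes "extends S c0 c" "extends T c c'" "S \<inter> T = {}" "\<And>k m. (k, m) \<in> bd S \<Longrightarrow> m \<notin> T"
  shows "extends (S \<union> T) c0 c'"
  unfolding extends_def
proof (intro conjI allI impI ballI)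
  show "c' v = c0 v" if "v \<notin> S \<union> T" for v using assms(1,2) that by (simp add: extends_def)
  show "fits c' v" if "v \<in> S \<union> T" for v
  proof (cases "v \<in> T")
    case True
    then show ?thesis using assms(2) by (simp add: extends_def)
  next
    case False
    show ?thesis
      by (rule fits_after[OF assms(1)]) (use False that assms(2-) in \<open>auto simp: extends_def\<close>)
  qed
qed

lemma realizes1_two_children:
  assumes N: "N u = {w, x, y}" "distinct [w, x, y]"
    and T: "realizes1 D T x u" "w \<notin> T" "bd T = {(x, u)}"
    and T': "realizes1 D' T' y u" "w \<notin> T'" "bd T' = {(y, u)}" and disj: "T \<inter> T' = {}"
    and D'': "\<forall>e. get D'' e \<longrightarrow> (\<exists>d. get D d \<and> src d = dst e \<and>
      (\<exists>d'. get D' d' \<and> src d' = dst e \<and> ok (dst e) [src e, dst d, dst d']))"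
  shows "realizes1 D'' (insert u (T \<union> T')) u w"
  unfolding realizes1_def
proof (intro allI impI)
  fix e c0 assume e: "get D'' e" "c0 w = src e"
  have wu: "w \<noteq> u" using N(1) irrefl by auto
  have m: "x \<in> T" "u \<notin> T" "y \<in> T'" "u \<notin> T'"
    using T(3) T'(3) boundary_iff[of x u E T] boundary_iff[of y u E T'] by auto
  obtain d d' where d: "get D d" "src d = dst e" "get D' d'" "src d' = dst e"
      "ok (dst e) [src e, dst d, dst d']" using D'' e(1) by blast
  obtain c where c: "extends T (c0(u := dst e)) c" "c x = dst d"
    using T(1) d(1,2) unfolding realizes1_def by (metis fun_upd_same)
  have cu: "c u = dst e" "c w = src e" using extends_outside[OF c(1)] T m wu e by auto
  obtain c' where c': "extends T' c c'" "c' y = dst d'"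
    using T'(1) d(3,4) cu(1) unfolding realizes1_def by metis
  have "x \<notin> T'" using m disj by auto
  then have o: "c' u = dst e" "c' w = src e" "c' x = dst d"
    using extends_outside[OF c'(1)] m T' cu c(2) by auto
  have "extends (T \<union> T') (c0(u := dst e)) c'"
    by (rule extends_Un[OF c(1) c'(1) disj]) (use T(3) m in auto)
  then have "extends (insert u (T \<union> T')) c0 c'"
    by (rule extends_insert[of "T \<union> T'" c0 u "dst e" c' "[w, x, y]"]) (use N c'(2) o d in auto)
  then show "\<exists>c. extends (insert u (T \<union> T')) c0 c \<and> c u = dst e" using o by blast
qed

lemma realizes1_cycle:
  assumes N: "N u = {w, x, y}" "distinct [w, x, y]"
    and T: "realizes2 M T x u y u" "w \<notin> T" "bd T = {(x, u), (y, u)}"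
    and D: "\<forall>e. get D e \<longrightarrow> (\<exists>d. src d = dst e \<and>
      (\<exists>d'. dst d' = dst e \<and> get (get M d) d' \<and> ok (dst e) [src e, dst d, src d']))"
  shows "realizes1 D (insert u T) u w"
  unfolding realizes1_def
proof (intro allI impI)
  fix e c0 assume e: "get D e" "c0 w = src e"
  have wu: "w \<noteq> u" using N(1) irrefl by auto
  have m: "u \<notin> T" using T(3) boundary_iff[of x u E T] by auto
  obtain d d' where d: "src d = dst e" "dst d' = dst e" "get (get M d) d'"
      "ok (dst e) [src e, dst d, src d']" using D e(1) by blast
  obtain c where c: "extends T (c0(u := dst e)) c" "c x = dst d" "c y = src d'"
    using T(1) d(1-3) unfolding realizes2_def by (metis fun_upd_same)
  have cu: "c u = dst e" "c w = src e" using extends_outside[OF c(1)] T m wu e by auto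
  have "extends (insert u T) c0 c"
    by (rule extends_insert[OF c(1) cu(1), of "[w, x, y]"]) (use N c cu d in auto)
  then show "\<exists>c. extends (insert u T) c0 c \<and> c u = dst e" using cu by blast
qed

lemma realizes2_vertex:
  assumes "N u = {w, q}" "distinct [w, q]"
    and M: "\<forall>e f. get (get M e) f \<longrightarrow> dst e = src f \<and> ok (dst e) [src e, dst f]"
  shows "realizes2 M {u} u w u q"
  unfolding realizes2_def
proof (intro allI impI)
  fix e f c0 assume e: "get (get M e) f" "c0 w = src e" "c0 q = dst f"
  have n: "w \<noteq> u" "q \<noteq> u" using assms(1) irrefl by auto
  have "extends {u} c0 (c0(u := dst e))"
    using fitsI[of u "[w, q]" "c0(u := dst e)"] assms(1,2) M[rule_format, OF e(1)] e n
    by (auto simp: extends_def)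
  then show "\<exists>c. extends {u} c0 c \<and> c u = dst e \<and> c u = src f"
    using M e(1) by (metis fun_upd_same)
qed

lemma realizes2_vertex_pendant:
  assumes N: "N u = {w, y, q}" "distinct [w, y, q]"
    and T: "realizes1 D T y u" "bd T = {(y, u)}" "w \<notin> T" "q \<notin> T"
    and M: "\<forall>e f. get (get M e) f \<longrightarrow> dst e = src f \<and>
      (\<exists>d. get D d \<and> src d = dst e \<and> ok (dst e) [src e, dst d, dst f])"
  shows "realizes2 M (insert u T) u w u q"
  unfolding realizes2_def
proof (intro allI impI)
  fix e f c0 assume e: "get (get M e) f" "c0 w = src e" "c0 q = dst f"
  have n: "w \<noteq> u" "q \<noteq> u" using N(1) irrefl by auto
  have m: "u \<notin> T" using T(2) boundary_iff[of y u E T] by auto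
  obtain d where d: "get D d" "src d = dst e" "ok (dst e) [src e, dst d, dst f]" using M e(1) by blast
  obtain c where c: "extends T (c0(u := dst e)) c" "c y = dst d"
    using T(1) d unfolding realizes1_def by (metis fun_upd_same)
  have cu: "c u = dst e" "c w = src e" "c q = dst f" using extends_outside[OF c(1)] T m n e by auto
  have "extends (insert u T) c0 c"
    by (rule extends_insert[OF c(1) cu(1), of "[w, y, q]"]) (use N c cu d in auto)
  then show "\<exists>c. extends (insert u T) c0 c \<and> c u = dst e \<and> c u = src f" using cu M e(1) by metis
qed

lemma realizes2_chord:
  assumes Nu: "N u = {w, a, b}" "distinct [w, a, b]" and Nb: "N b = {q, p, u}" "distinct [q, p, u]"
    and T: "realizes2 M T a u p b" "bd T = {(a, u), (p, b)}" "w \<notin> T" "q \<notin> T"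
    and M': "\<forall>e f. get (get M' e) f \<longrightarrow> (\<exists>d. src d = dst e \<and> ok (dst e) [src e, dst d, src f] \<and>
      (\<exists>d'. dst d' = src f \<and> get (get M d) d' \<and> ok (src f) [dst f, src d', dst e]))"
  shows "realizes2 M' (insert u (insert b T)) u w b q"
  unfolding realizes2_def
proof (intro allI impI)
  fix e f c0 assume e: "get (get M' e) f" "c0 w = src e" "c0 q = dst f"
  have n: "w \<noteq> u" "q \<noteq> b" "u \<noteq> b" "w \<noteq> b" "q \<noteq> u" using Nu Nb irrefl by auto
  have m: "u \<notin> T" "b \<notin> T" using T(2) boundary_iff[of a u E T] boundary_iff[of p b E T] by auto
  obtain d d' where d: "src d = dst e" "ok (dst e) [src e, dst d, src f]" "dst d' = src f"
      "get (get M d) d'" "ok (src f) [dst f, src d', dst e]"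
    using M' e(1) by blast
  let ?c0 = "c0(u := dst e, b := src f)"
  have "?c0 u = src d" "?c0 b = dst d'" using n d by auto
  then obtain c where c: "extends T ?c0 c" "c a = dst d" "c p = src d'"
    using T(1) d(4) unfolding realizes2_def by blast
  have cu: "c u = dst e" "c b = src f" "c w = src e" "c q = dst f"
    using extends_outside[OF c(1)] T m n e by auto
  \<comment> \<open>\<open>b\<close> is absorbed first, while \<open>u\<close> still counts as an
    outer vertex of prescribed label.\<close>
  have "extends (insert b T) (c0(u := dst e)) c"
    by (rule extends_insert[OF c(1) cu(2), of "[q, p, u]"]) (use Nb c cu d in auto)
  then have "extends (insert u (insert b T)) c0 c"
    by (rule extends_insert[of "insert b T" c0 u "dst e" c "[w, a, b]"]) (use Nu c cu d in auto)
  then show "\<exists>c. extends (insert u (insert b T)) c0 c \<and> c u = dst e \<and> c b = src f"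
    using cu by blast
qed

text \<open>The joint edge from \<open>b\<close> to \<open>q\<close> gets an intermediate state
  \<open>h\<close>. \<open>R\<close> is extended first, with the provisional label
  \<open>src h\<close> at \<open>b\<close>, then \<open>P\<close> against the label that
  \<open>q\<close> received. As \<open>P\<close> gives \<open>b\<close> the label
  \<open>src h\<close> again, the conditions on \<open>R\<close> remain valid.\<close>

lemma realizes2_append:
  assumes P: "realizes2 M P u w b q" and R: "realizes2 M' R q b u' w'"
    and disj: "P \<inter> R = {}" and m: "u \<in> P" "b \<in> P" "q \<in> R" "u' \<in> R" "w \<notin> P" "w \<notin> R" "w' \<notin> P"
    and bR: "bd R = {(q, b), (u', w')}"
  shows "realizes2 (compose M M') (P \<union> R) u w u' w'"
  unfolding realizes2_def
proof (intro allI impI)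
  fix e f c0 assume e: "get (get (compose M M') e) f" "c0 w = src e" "c0 w' = dst f"
  obtain h where h: "get (get M e) h" "get (get M' h) f" using e(1) by (auto simp: get_compose)
  have n: "w' \<noteq> b" "w \<noteq> b" using m by auto
  let ?c0 = "c0(b := src h)"
  have "?c0 b = src h" "?c0 w' = dst f" using n e by auto
  then obtain c where c: "extends R ?c0 c" "c q = dst h" "c u' = src f"
    using R h(2) unfolding realizes2_def by blast
  have cw: "c w = src e" using extends_outside[OF c(1)] m n e by auto
  then obtain c' where c': "extends P c c'" "c' u = dst e" "c' b = src h"
    using P h(1) c(2) unfolding realizes2_def by blast
  have "c b = src h" using extends_outside[OF c(1), of b] m disj by auto
  have "fits c' v" if "v \<in> R" for v
  proof (rule fits_after[OF c(1) that])
    show "c' k = c k" if "k \<in> R" for k using extends_outside[OF c'(1)] that disj by auto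
    show "c' l = c l" if "(k, l) \<in> bd R" for k l
      using that extends_outside[OF c'(1), of w'] m \<open>c b = src h\<close> c'(3) unfolding bR by auto
  qed
  moreover have "c' v = c0 v" if "v \<notin> P \<union> R" for v
    using extends_outside[OF c'(1), of v] extends_outside[OF c(1), of v] that m by auto
  ultimately have "extends (P \<union> R) c0 c'" using c'(1) by (auto simp: extends_def)
  moreover have "c' u' = src f" using extends_outside[OF c'(1), of u'] disj m c(3) by auto
  ultimately show "\<exists>c. extends (P \<union> R) c0 c \<and> c u = dst e \<and> c u' = src f" using c'(2) by blast
qed


section \<open>Every piece realizes a listed bound, and every graph is completed\<close>

lemma link_ends: "link P u w b q \<Longrightarrow> u \<in> P \<and> b \<in> P \<and> w \<notin> P"
  by (cases rule: link.cases) (use irrefl in auto)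

text \<open>The ends decide the family: equal ends mean a single vertex, possibly with a pendant
  piece, and only these need \<open>vertex_links\<close>.\<close>

lemma realizable:
  shows "pendant S u w \<Longrightarrow> \<exists>D\<in>set pendant_sets. realizes1 D S u w"
    and "link P a c b d \<Longrightarrow> \<exists>M\<in>set (if a = b then vertex_links else chord_links). realizes2 M P a c b d"
    and "chain T x y x' y' \<Longrightarrow> \<exists>M\<in>set (if x = x' then vertex_links else long_chains). realizes2 M T x y x' y'"
proof (induct rule: pendant_link_chain.inducts)
  case (leaf u w)
  then have "w \<noteq> u" using irrefl by auto
  then show ?case
    using realizes1_leaf[OF leaf] leaf_closed by blast
next
  case (one_child u w x T)
  obtain D where D: "D \<in> set pendant_sets" "realizes1 D T x u" using one_child by blast
  have m: "u \<notin> T" "x \<in> T" using one_child boundary_iff[of x u E T] by auto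
  obtain D' where "D' \<in> set pendant_sets"
      "\<forall>e. get D' e \<longrightarrow> (\<exists>d. get D d \<and> src d = dst e \<and> ok (dst e) [src e, dst d])"
    using bspec[OF one_child_closed D(1)] by blast
  then show ?case using realizes1_one_child[OF one_child(1,2) D(2) m(1) one_child(6) m(2)] by blast
next
  case (two_children u w x y T T')
  obtain D where D: "D \<in> set pendant_sets" "realizes1 D T x u" using two_children by blast
  obtain D' where D': "D' \<in> set pendant_sets" "realizes1 D' T' y u" using two_children by blast
  obtain D'' where "D'' \<in> set pendant_sets"
      "\<forall>e. get D'' e \<longrightarrow> (\<exists>d. get D d \<and> src d = dst e \<and>
        (\<exists>d'. get D' d' \<and> src d' = dst e \<and> ok (dst e) [src e, dst d, dst d']))"
    using bspec[OF bspec[OF two_children_closed D(1)] D'(1)] by blast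
  then show ?case
    using realizes1_two_children[OF two_children(1,2) D(2) _ _ D'(2)] two_children by blast
next
  case (cycle u w x y T)
  then have "x \<noteq> y" by simp
  then obtain M where M: "M \<in> set long_chains" "realizes2 M T x u y u" using cycle by auto
  obtain D where "D \<in> set pendant_sets"
      "\<forall>e. get D e \<longrightarrow> (\<exists>d. src d = dst e \<and>
        (\<exists>d'. dst d' = dst e \<and> get (get M d) d' \<and> ok (dst e) [src e, dst d, src d']))"
    using bspec[OF cycle_closed M(1)] by blast
  then show ?case using realizes1_cycle[OF cycle(1,2) M(2) cycle(6,5)] by blast
next
  case (vertex u w q)
  obtain M where "M \<in> set vertex_links"
      "\<forall>e f. get (get M e) f \<longrightarrow> dst e = src f \<and> ok (dst e) [src e, dst f]"
    using vertex_closed by blast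
  then show ?case using realizes2_vertex[OF vertex] by auto
next
  case (vertex_pendant u w y q T)
  obtain D where D: "D \<in> set pendant_sets" "realizes1 D T y u" using vertex_pendant by blast
  obtain M where "M \<in> set vertex_links"
      "\<forall>e f. get (get M e) f \<longrightarrow> dst e = src f \<and>
        (\<exists>d. get D d \<and> src d = dst e \<and> ok (dst e) [src e, dst d, dst f])"
    using bspec[OF vertex_pendant_closed D(1)] by blast
  then show ?case
    using realizes2_vertex_pendant[OF vertex_pendant(1,2) D(2) vertex_pendant(5-7)] by auto
next
  case (chord u w a b q p T)
  have "u \<noteq> b" using chord(1) irrefl by auto
  obtain M where M: "M \<in> set chains" "realizes2 M T a u p b"
    using chord(6) unfolding chains_def by (auto split: if_splits)
  obtain M' where "M' \<in> set chord_links"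
      "\<forall>e f. get (get M' e) f \<longrightarrow> (\<exists>d. src d = dst e \<and> ok (dst e) [src e, dst d, src f] \<and>
        (\<exists>d'. dst d' = src f \<and> get (get M d) d' \<and> ok (src f) [dst f, src d', dst e]))"
    using bspec[OF chord_closed M(1)] by blast
  then show ?case
    using realizes2_chord[OF chord(1-4) M(2) chord(7-9)] \<open>u \<noteq> b\<close> by auto
next
  case (single P u w b q)
  show ?case
  proof (cases "u = b")
    case True
    then show ?thesis using single(2) by simp
  next
    case False
    then obtain M where "M \<in> set chord_links" "realizes2 M P u w b q" using single(2) by auto
    then show ?thesis
      using False realizes2_mono chord_long_closed by simp blast
  qed
next
  case (append P u w b q R u' w')
  have "u \<noteq> u'" using append by blast
  obtain M where M: "M \<in> set links" "realizes2 M P u w b q"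
    using append(2) unfolding links_def by (auto split: if_splits)
  obtain M' where M': "M' \<in> set chains" "realizes2 M' R q b u' w'"
    using append(4) unfolding chains_def by (auto split: if_splits)
  have "realizes2 (compose M M') (P \<union> R) u w u' w'"
    using link_ends[OF append(1)] by (intro realizes2_append[OF M(2) M'(2)]) (use append in auto)
  moreover obtain M'' where "M'' \<in> set long_chains" "rel_le M'' (compose M M')"
    using bspec[OF bspec[OF append_closed M(1)] M'(1)] by blast
  ultimately show ?case using realizes2_mono[of "compose M M'" "P \<union> R" u w u' w' M''] \<open>u \<noteq> u'\<close>
    by auto
qed

lemma component_labelling:
  assumes tf: "theta_free E" and S: "S \<subseteq> V" "conn E S" "bd S = {}" "S \<noteq> {}"
  shows "\<exists>c. \<forall>v\<in>S. fits c v"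
  using tf S
proof (cases rule: low_degree_or_K4)
  case (2 u x y z)
  \<comment> \<open>On \<open>K_4\<close> the edge \<open>u x\<close> becomes blue and
    \<open>y z\<close> red, the smallest red star.\<close>
  let ?c = "(\<lambda>_. Bl)(y := Ctr, z := Lf)"
  have "fits ?c u" by (rule fitsI[of _ "[x, y, z]"]) (use 2 in auto)
  moreover have "fits ?c x" by (rule fitsI[of _ "[u, y, z]"]) (use 2 in auto)
  moreover have "fits ?c y" by (rule fitsI[of _ "[u, x, z]"]) (use 2 in auto)
  moreover have "fits ?c z" by (rule fitsI[of _ "[u, x, y]"]) (use 2 in auto)
  ultimately show ?thesis unfolding 2(2) by (intro exI[of _ ?c]) simp
next
  case (1 u)
  let ?C = "component E (S - {u})"
  have C: "?C x \<subseteq> S - {u}" "conn E (?C x)" for x by (rule component_subset, rule conn_component)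
  have CV: "?C x \<subseteq> V" for x using C(1) S(1) by blast
  have NS: "N u \<inter> S = N u" using S(3) 1(1) boundary_iff[of u _ E S] by auto
  have Cself: "x \<in> ?C x" if "x \<in> N u" for x
    using that irrefl NS by (intro component_self) auto
  have bC: "bd (?C x) = {(k, u) | k. k \<in> N u \<inter> ?C x}" for x
    using component_boundary_eq[OF HOL.refl 1(1), of x] S(3) by auto
  note cover = component_cover_eq[OF S(2) 1(1) NS]
  from finite_N 1(2) show ?thesis
  proof (cases rule: card_le_2_cases)
    case 1
    have "S = {u}" using cover 1 by simp
    then show ?thesis using fitsI[of u "[]" "\<lambda>_. Bl"] 1 by auto
  next
    case (2 x)
    have So: "insert u (?C x) = S" using cover 2 by simp
    have "N u \<inter> ?C x = {x}" unfolding 2 using Cself[of x] 2 by auto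
    then have "bd (?C x) = {(x, u)}" using bC[of x] by simp
    then obtain D where D: "D \<in> set pendant_sets" "realizes1 D (?C x) x u"
      using realizable(1)[OF pendant_decomposition[OF tf CV C(2)]] by blast
    obtain d where d: "get D d" "ok (src d) [dst d]"
      using bspec[OF root_one_closed D(1)] by blast
    \<comment> \<open>The blue background is arbitrary, as \<open>u\<close> is the only outer
      neighbour of the piece.\<close>
    obtain c where c: "extends (?C x) ((\<lambda>_. Bl)(u := src d)) c" "c x = dst d"
      using D(2) d(1) unfolding realizes1_def by (metis fun_upd_same)
    have cu: "c u = src d" using extends_outside[OF c(1), of u] C(1)[of x] by auto
    have "extends (insert u (?C x)) (\<lambda>_. Bl) c"
      by (rule extends_insert[OF c(1) cu, of "[x]"]) (use 2 c d in auto)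
    then show ?thesis unfolding So extends_def by blast
  next
    case (3 x y)
    have xx: "x \<in> ?C x" "y \<in> ?C y" using Cself 3 by auto
    show ?thesis
    proof (cases "y \<in> ?C x")
      case True
      then have "?C y = ?C x" by (rule component_eq)
      then have So: "insert u (?C x) = S" using cover 3 by simp
      have "N u \<inter> ?C x = {x, y}" unfolding 3(1) using xx True by auto
      then have "bd (?C x) = {(x, u), (y, u)}" using bC[of x] by auto
      then have "chain (?C x) x u y u"
        by (rule chain_decomposition[OF tf CV C(2) _ _ conn_singleton[of E u]]) (use 3(2) C(1)[of x] in auto)
      from realizable(3)[OF this] obtain M where M: "M \<in> set long_chains" "realizes2 M (?C x) x u y u"
        using 3(2) by auto
      obtain d d' where d: "dst d' = src d" "get (get M d) d'" "ok (src d) [dst d, src d']"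
        using bspec[OF root_cycle_closed M(1)] by blast
      obtain c where c: "extends (?C x) ((\<lambda>_. Bl)(u := src d)) c" "c x = dst d" "c y = src d'"
        using M(2) d(1,2) unfolding realizes2_def by (metis fun_upd_same)
      have cu: "c u = src d" using extends_outside[OF c(1), of u] C(1)[of x] by auto
      have "extends (insert u (?C x)) (\<lambda>_. Bl) c"
        by (rule extends_insert[OF c(1) cu, of "[x, y]"]) (use 3 c d in auto)
      then show ?thesis unfolding So extends_def by blast
    next
      case False
      have disj: "?C x \<inter> ?C y = {}" by (rule component_disjoint[OF False])
      have xy: "x \<notin> ?C y" using False component_sym by metis
      have So: "insert u (?C x \<union> ?C y) = S" using cover 3(1) by simp
      have "N u \<inter> ?C x = {x}" "N u \<inter> ?C y = {y}" unfolding 3(1) using xx False xy by auto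
      then have b: "bd (?C x) = {(x, u)}" "bd (?C y) = {(y, u)}" using bC by auto
      obtain D where D: "D \<in> set pendant_sets" "realizes1 D (?C x) x u"
        using realizable(1)[OF pendant_decomposition[OF tf CV C(2) b(1)]] by blast
      obtain D' where D': "D' \<in> set pendant_sets" "realizes1 D' (?C y) y u"
        using realizable(1)[OF pendant_decomposition[OF tf CV C(2) b(2)]] by blast
      obtain d d' where d: "get D d" "get D' d'" "src d' = src d" "ok (src d) [dst d, dst d']"
        using bspec[OF bspec[OF root_two_closed D(1)] D'(1)] by blast
      obtain c where c: "extends (?C x) ((\<lambda>_. Bl)(u := src d)) c" "c x = dst d"
        using D(2) d(1) unfolding realizes1_def by (metis fun_upd_same)
      have cu: "c u = src d" using extends_outside[OF c(1), of u] C(1)[of x] by auto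
      obtain c' where c': "extends (?C y) c c'" "c' y = dst d'"
        using D'(2) d(2,3) cu unfolding realizes1_def by metis
      have o: "c' u = src d" "c' x = dst d"
        using extends_outside[OF c'(1), of u] extends_outside[OF c'(1), of x] C(1)[of y] xy cu c(2) by auto
      have "extends (?C x \<union> ?C y) ((\<lambda>_. Bl)(u := src d)) c'"
        by (rule extends_Un[OF c(1) c'(1) disj]) (use b C(1)[of y] in auto)
      then have "extends (insert u (?C x \<union> ?C y)) (\<lambda>_. Bl) c'"
        by (rule extends_insert[of "?C x \<union> ?C y" _ u "src d" c' "[x, y]"]) (use 3 c' o d in auto)
      then show ?thesis unfolding So extends_def by blast
    qed
  qed
qed

theorem labelling:
  assumes "theta_free E"
  obtains c where "\<And>v. v \<in> V \<Longrightarrow> fits c v"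
proof -
  have "\<forall>x\<in>V. \<exists>c. \<forall>v\<in>component E V x. fits c v"
  proof
    fix x assume x: "x \<in> V"
    have "k \<in> component E V x" if "j \<in> component E V x" "E j k" for j k
      using component_closed[of j E V x k, OF that] edge_V[OF sym[OF that(2)]] by simp
    then have "bd (component E V x) = {}" by (auto simp: boundary_def)
    then show "\<exists>c. \<forall>v\<in>component E V x. fits c v"
      using component_labelling[OF assms component_subset conn_component] component_self[OF x] by blast
  qed
  note ex = this
  \<comment> \<open>The choice depends on the component as a set, so that adjacent vertices use the
    same labelling.\<close>
  define f where "f K = (SOME c. \<forall>v\<in>K. fits c v)" for K
  have f: "fits (f (component E V x)) v" if "x \<in> V" "v \<in> component E V x" for x v
    using someI_ex[OF bspec[OF ex that(1)]] that(2) unfolding f_def by blast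
  have "fits (\<lambda>v. f (component E V v) v) v" if v: "v \<in> V" for v
  proof (rule fits_cong)
    show "fits (f (component E V v)) v" by (rule f[OF v component_self[OF v]])
    show "f (component E V k) k = f (component E V v) k" if "E v k" for k
    proof -
      have "k \<in> component E V v"
        using component_closed[of v E V v k, OF component_self[OF v] that] edge_V[OF sym[OF that]] by simp
      then show ?thesis using component_eq by metis
    qed
  qed simp
  then show ?thesis using that by blast
qed

end

section \<open>From labels back to red and blue\<close>

lemma none_iff: "none l ks \<longleftrightarrow> l \<notin> set ks"
  by (induction ks) auto

lemma at_most_oneD:
  "\<lbrakk>at_most_one l (map c ns); x \<in> set ns; y \<in> set ns; c x = l; c y = l\<rbrakk> \<Longrightarrow> x = y"
  by (induction ns) (auto simp: none_iff image_iff split: if_splits)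

lemma exactly_oneD: "exactly_one l ks \<Longrightarrow> at_most_one l ks \<and> l \<in> set ks"
  by (induction ks) (auto split: if_splits)

context subcubic_graph
begin

lemma fits_Bl: "\<lbrakk>fits c v; c v = Bl; E v x; E v y; c x = Bl; c y = Bl\<rbrakk> \<Longrightarrow> x = y"
  unfolding fits_def using at_most_oneD[of Bl c] by auto

lemma fits_Ctr:
  assumes "fits c v" "c v = Ctr"
  shows "\<exists>x. E v x \<and> c x = Lf" "E v x \<Longrightarrow> c x \<noteq> Ctr"
  using assms unfolding fits_def by (auto simp: none_iff image_iff dest: HOL.sym)

lemma fits_Lf:
  assumes "fits c v" "c v = Lf"
  shows "\<exists>x. E v x \<and> c x = Ctr" "\<lbrakk>E v x; E v y; c x \<noteq> Bl; c y \<noteq> Bl\<rbrakk> \<Longrightarrow> x = y"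
proof -
  obtain ns where ns: "set ns = N v" "Lf \<notin> c ` N v" "exactly_one Ctr (map c ns)"
    using assms unfolding fits_def by (auto simp: none_iff)
  show "\<exists>x. E v x \<and> c x = Ctr" using exactly_oneD[OF ns(3)] ns(1) by auto
  assume xy: "E v x" "E v y" "c x \<noteq> Bl" "c y \<noteq> Bl"
  then have "c x \<noteq> Lf" "c y \<noteq> Lf" using ns(2) by (metis image_eqI mem_Collect_eq)+
  then have "c x = Ctr" "c y = Ctr" using xy label.exhaust by blast+
  then show "x = y" using at_most_oneD[of Ctr c ns x y] exactly_oneD[OF ns(3)] ns(1) xy by simp
qed

text \<open>An inner vertex of the path has two red neighbours and so is not a leaf;
  \<open>y\<close> and \<open>z\<close> would both be centers, but adjacent centers are
  forbidden.\<close>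

lemma no_red_path:
  assumes "\<And>v. v \<in> V \<Longrightarrow> fits c v" "E x y" "E y z" "E z w" "distinct [x, y, z, w]"
    and "c x \<noteq> Bl" "c y \<noteq> Bl" "c z \<noteq> Bl" "c w \<noteq> Bl"
  shows False
proof (cases "c y")
  case Lf
  then show False using fits_Lf(2)[of c y x z] assms edge_V[of y z] sym by auto
next
  case Ctr
  have V: "y \<in> V" "z \<in> V" using edge_V assms(3,4) by blast+
  then have "c z = Lf" using fits_Ctr(2)[OF assms(1) Ctr assms(3)] assms(8) label.exhaust by blast
  then show False using fits_Lf(2)[OF assms(1), of z y w] V(2) assms sym by auto
qed (use assms in simp)

end

theorem theorem1p1:
  fixes G :: "'a pair_pre_digraph"
  assumes "pair_graph G"
    and "subcubic (with_proj G)"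
    and "outerplanar G"
  shows "\<exists>c. crumby_coloring (with_proj G) c"
proof -
  interpret pg: pair_graph G by (rule assms(1))
  let ?E = "\<lambda>u v. (u, v) \<in> parcs G"
  \<comment> \<open>The locale bounds the degree at every element of the type, hence the case
    outside the graph, where no arc starts.\<close>
  have deg: "card {v. ?E u v} \<le> 3" for u
  proof (cases "u \<in> pverts G")
    case True
    have "bij_betw (Pair u) {v. ?E u v} (out_arcs (with_proj G) u)"
      by (auto simp: bij_betw_def inj_on_def out_arcs_def)
    then have "card {v. ?E u v} = out_degree (with_proj G) u"
      by (simp add: out_degree_def bij_betw_same_card)
    then show ?thesis using assms(2) True by (simp add: subcubic_def)
  next
    case False
    then have "{v. ?E u v} = {}" using pair_graph_arcD[OF assms(1)] by blast
    then show ?thesis by simp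
  qed
  interpret subcubic_graph ?E "pverts G"
    by unfold_locales (use deg in \<open>auto simp: pg.pair_finite_verts dest: pair_graph_arcD[OF assms(1)]\<close>)
  obtain c where c: "\<And>v. v \<in> pverts G \<Longrightarrow> fits c v"
    using labelling[OF outerplanar_theta_free[OF assms(1,3)]] by blast
  define col where "col v = (if c v = Bl then Blue else Red)" for v
  have "out_degree (color_subgraph (with_proj G) col Blue) v \<le> 1"
    if "v \<in> verts (color_subgraph (with_proj G) col Blue)" for v
  proof -
    have v: "v \<in> pverts G" "c v = Bl"
      using that by (auto simp: color_subgraph_def col_def split: if_splits)
    have "e = e'" if "e \<in> out_arcs (color_subgraph (with_proj G) col Blue) v"
        "e' \<in> out_arcs (color_subgraph (with_proj G) col Blue) v" for e e'
      using that fits_Bl[OF c[OF v(1)] v(2), of "snd e" "snd e'"]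
      by (cases e; cases e') (auto simp: color_subgraph_def col_def out_arcs_def induce_subgraph_def split: if_splits)
    moreover have "out_arcs (color_subgraph (with_proj G) col Blue) v \<subseteq> parcs G"
      by (auto simp: color_subgraph_def induce_subgraph_def out_arcs_def)
    then have "finite (out_arcs (color_subgraph (with_proj G) col Blue) v)"
      using finite_subset pg.pair_finite_arcs by blast
    ultimately show ?thesis unfolding out_degree_def One_nat_def by (subst card_le_Suc0_iff_eq) blast+
  qed
  moreover have "\<exists>u \<in> verts (color_subgraph (with_proj G) col Red). v \<rightarrow>\<^bsub>color_subgraph (with_proj G) col Red\<^esub> u"
    if "v \<in> verts (color_subgraph (with_proj G) col Red)" for v
  proof -
    have v: "v \<in> pverts G" "c v \<noteq> Bl"
      using that by (auto simp: color_subgraph_def col_def split: if_splits)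
    then obtain u where u: "?E v u" "c u \<noteq> Bl"
      using fits_Ctr(1)[OF c] fits_Lf(1)[OF c] by (metis label.distinct(1,3) label.exhaust)
    then have "u \<in> pverts G" using pair_graph_arcD[OF assms(1)] by blast
    then show ?thesis using u v
      by (intro bexI[of _ u]) (force simp: color_subgraph_def col_def induce_subgraph_def arcs_ends_def arc_to_ends_def)+
  qed
  moreover have False
    if ap: "pre_digraph.apath (color_subgraph (with_proj G) col Red) u p v" and len: "length p = 3" for u p v
  proof -
    obtain e1 e2 e3 where p: "p = [e1, e2, e3]"
      using len unfolding numeral_3_eq_3 length_Suc_conv by blast
    define x y z w where "x = fst e1" and "y = fst e2" and "z = fst e3" and "w = snd e3"
    have cas: "snd e1 = y" "snd e2 = z" and d: "distinct [x, y, z, w]"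
      and sub: "{e1, e2, e3} \<subseteq> arcs (color_subgraph (with_proj G) col Red)"
      using ap unfolding p pre_digraph.apath_def pre_digraph.awalk_def x_def y_def z_def w_def
      by (auto simp: color_subgraph_def pre_digraph.cas.simps pre_digraph.awalk_verts.simps)
    have "e1 = (x, y)" "e2 = (y, z)" "e3 = (z, w)"
      using cas by (simp_all add: prod_eq_iff x_def y_def z_def w_def)
    with sub have "?E x y" "?E y z" "?E z w" "c x \<noteq> Bl" "c y \<noteq> Bl" "c z \<noteq> Bl" "c w \<noteq> Bl"
      by (auto simp: color_subgraph_def col_def induce_subgraph_def split: if_splits)
    then show False using no_red_path[OF c _ _ _ d] by blast
  qed
  ultimately show ?thesis unfolding crumby_coloring_def Let_def by blast
qed

end
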